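(* Let $\Sigma$ be a non-empty set of prime numbers. Let $\Omega=\mathcal{C}*P$ be the free pro-$\Sigma$ product of a procyclic pro-$\Sigma$ group $\mathcal{C}$, topologically generated by an element $x$, and a pro-$\Sigma$ group $P$. Let $m\geq 2$ be an integer. Then, for every $n\in\mathbb{Z}$ such that $x^n\neq 1$ in $\mathcal{C}$, $$C_{\Omega^{m}}(x^{n})\subset\overline{\langle x\rangle}\cdot(\Omega^{m})^{[m-1]}$$ as subgroups of $\Omega^{m}$, where $\overline{\langle x\rangle}$ denotes the closed subgroup of $\Omega^{m}$ topologically generated by the image of $x$ (and $x^n$ on the left-hand side denotes the image in $\Omega^m$).
   Context: A pro-$\Sigma$ group is an inverse limit of finite groups whose orders have all prime factors in $\Sigma$. The free pro-$\Sigma$ product is the coproduct in the category of pro-$\Sigma$ groups. The topological derived series of a profinite group $G$ is $G^{[0]}=G$, $G^{[m]}=\overline{[G^{[m-1]},G^{[m-1]}]}$ (closed subgroup topologically generated by commutators) for $m\ge1$, and $G^{m}:=G/G^{[m]}$ is the maximal $m$-step solvable quotient. $C_G(y)=\{g\in G\mid gy=yg\}$. *)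

theory Defs
  imports
    "HOL-Analysis.Analysis"
    "HOL-Algebra.Generated_Groups"
    "HOL-Algebra.Product_Groups"
begin

section \<open>Topological groups\<close>

record 'a topgroup = "'a monoid" +
  gtop :: "'a topology"

definition topological_group :: "'a topgroup \<Rightarrow> bool" where
  "topological_group G \<longleftrightarrow>
     group G \<and> topspace (gtop G) = carrier G \<and>
     continuous_map (prod_topology (gtop G) (gtop G)) (gtop G) (\<lambda>(a, b). a \<otimes>\<^bsub>G\<^esub> b) \<and>
     continuous_map (gtop G) (gtop G) (\<lambda>a. inv\<^bsub>G\<^esub> a)"

definition cont_hom :: "'a topgroup \<Rightarrow> 'b topgroup \<Rightarrow> ('a \<Rightarrow> 'b) set" where
  "cont_hom G H = {h \<in> hom G H. continuous_map (gtop G) (gtop H) h}"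

definition top_iso :: "'a topgroup \<Rightarrow> 'b topgroup \<Rightarrow> ('a \<Rightarrow> 'b) set" where
  "top_iso G H = {h \<in> iso G H. homeomorphic_map (gtop G) (gtop H) h}"

definition closed_generate :: "'a topgroup \<Rightarrow> 'a set \<Rightarrow> 'a set" where
  "closed_generate G S = gtop G closure_of (generate G S)"

definition centralizer :: "('a, 'm) monoid_scheme \<Rightarrow> 'a \<Rightarrow> 'a set" where
  "centralizer G y = {g \<in> carrier G. g \<otimes>\<^bsub>G\<^esub> y = y \<otimes>\<^bsub>G\<^esub> g}"

definition quotient_topgroup :: "'a topgroup \<Rightarrow> 'a set \<Rightarrow> 'a set topgroup" where
  "quotient_topgroup G N =
     monoid.extend (G Mod N)
       \<lparr>gtop = topology (\<lambda>\<U>. \<U> \<subseteq> carrier (G Mod N) \<and> openin (gtop G) (\<Union>\<U>))\<rparr>"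

lemma openin_quotient_topgroup:
  assumes G: "topological_group G" and N: "subgroup N G"
  shows "openin (gtop (quotient_topgroup G N)) \<U> \<longleftrightarrow>
           \<U> \<subseteq> carrier (G Mod N) \<and> openin (gtop G) (\<Union>\<U>)"
proof -
  interpret group G using G by (simp add: topological_group_def)
  have disj: "A = B" if "A \<in> carrier (G Mod N)" "B \<in> carrier (G Mod N)" "z \<in> A" "z \<in> B" for A B z
    using rcos_disjoint[OF N] that by (auto simp: FactGroup_def pairwise_def disjnt_def)
  have "istopology (\<lambda>\<U>. \<U> \<subseteq> carrier (G Mod N) \<and> openin (gtop G) (\<Union>\<U>))"
    unfolding istopology_def
  proof (intro conjI allI impI)
    fix S T
    assume S: "S \<subseteq> carrier (G Mod N) \<and> openin (gtop G) (\<Union>S)"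
      and T: "T \<subseteq> carrier (G Mod N) \<and> openin (gtop G) (\<Union>T)"
    have "\<Union>(S \<inter> T) = \<Union>S \<inter> \<Union>T"
    proof
      show "\<Union>S \<inter> \<Union>T \<subseteq> \<Union>(S \<inter> T)"
      proof
        fix z assume "z \<in> \<Union>S \<inter> \<Union>T"
        then obtain A B where "A \<in> S" "z \<in> A" "B \<in> T" "z \<in> B" by blast
        moreover have "A = B" using S T calculation disj by (meson subsetD)
        ultimately show "z \<in> \<Union>(S \<inter> T)" by blast
      qed
    qed blast
    then show "openin (gtop G) (\<Union>(S \<inter> T))" using S T by auto
    show "S \<inter> T \<subseteq> carrier (G Mod N)" using S by blast
  next
    fix \<K> :: "'a set set set"
    assume *: "\<forall>K\<in>\<K>. K \<subseteq> carrier (G Mod N) \<and> openin (gtop G) (\<Union>K)"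
    then show "\<Union>\<K> \<subseteq> carrier (G Mod N)" by blast
    have "\<Union>(\<Union>\<K>) = \<Union>((\<lambda>K. \<Union>K) ` \<K>)" by blast
    then show "openin (gtop G) (\<Union>(\<Union>\<K>))" using * by (metis (no_types, lifting) imageE openin_Union)
  qed
  then show ?thesis
    by (simp add: quotient_topgroup_def monoid.defs topology_inverse')
qed

section \<open>Pro-\<open>\<Sigma>\<close> groups\<close>

definition directed_preorder :: "'i set \<Rightarrow> ('i \<Rightarrow> 'i \<Rightarrow> bool) \<Rightarrow> bool" where
  "directed_preorder I R \<longleftrightarrow>
     I \<noteq> {} \<and> (\<forall>i\<in>I. R i i) \<and>
     (\<forall>i\<in>I. \<forall>j\<in>I. \<forall>k\<in>I. R i j \<longrightarrow> R j k \<longrightarrow> R i k) \<and>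
     (\<forall>i\<in>I. \<forall>j\<in>I. \<exists>k\<in>I. R i k \<and> R j k)"

definition inverse_system ::
  "'i set \<Rightarrow> ('i \<Rightarrow> 'i \<Rightarrow> bool) \<Rightarrow> ('i \<Rightarrow> 'b monoid) \<Rightarrow> ('i \<Rightarrow> 'i \<Rightarrow> 'b \<Rightarrow> 'b) \<Rightarrow> bool" where
  "inverse_system I R Q \<phi> \<longleftrightarrow>
     directed_preorder I R \<and>
     (\<forall>i\<in>I. group (Q i)) \<and>
     (\<forall>i\<in>I. \<forall>j\<in>I. R i j \<longrightarrow> \<phi> i j \<in> hom (Q j) (Q i)) \<and>
     (\<forall>i\<in>I. \<forall>a\<in>carrier (Q i). \<phi> i i a = a) \<and>
     (\<forall>i\<in>I. \<forall>j\<in>I. \<forall>k\<in>I. R i j \<longrightarrow> R j k \<longrightarrow>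
        (\<forall>a\<in>carrier (Q k). \<phi> i j (\<phi> j k a) = \<phi> i k a))"

definition inverse_limit ::
  "'i set \<Rightarrow> ('i \<Rightarrow> 'i \<Rightarrow> bool) \<Rightarrow> ('i \<Rightarrow> 'b monoid) \<Rightarrow> ('i \<Rightarrow> 'i \<Rightarrow> 'b \<Rightarrow> 'b) \<Rightarrow> ('i \<Rightarrow> 'b) topgroup" where
  "inverse_limit I R Q \<phi> =
     (let L = {a \<in> carrier (product_group I Q). \<forall>i\<in>I. \<forall>j\<in>I. R i j \<longrightarrow> \<phi> i j (a j) = a i}
      in monoid.extend ((product_group I Q)\<lparr>carrier := L\<rparr>)
           \<lparr>gtop = subtopology (product_topology (\<lambda>i. discrete_topology (carrier (Q i))) I) L\<rparr>)"

definition finite_sigma_group :: "nat set \<Rightarrow> 'b monoid \<Rightarrow> bool" where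
  "finite_sigma_group \<Sigma> Q \<longleftrightarrow>
     group Q \<and> finite (carrier Q) \<and> (\<forall>p. prime p \<longrightarrow> p dvd order Q \<longrightarrow> p \<in> \<Sigma>)"

text \<open>
  Fixing the types of the inverse system loses nothing: an inverse limit \<open>G\<close> of finite
  \<open>\<Sigma>\<close>-groups is the inverse limit of its quotients by open normal subgroups, which are indexed
  by subsets of \<open>carrier G\<close>, and every finite group is isomorphic to one with elements in \<open>nat\<close>.
\<close>

definition pro_sigma_group :: "nat set \<Rightarrow> 'a topgroup \<Rightarrow> bool" where
  "pro_sigma_group \<Sigma> G \<longleftrightarrow>
     topological_group G \<and>
     (\<exists>(I :: 'a set set) R (Q :: 'a set \<Rightarrow> nat monoid) \<phi>.
        inverse_system I R Q \<phi> \<and> (\<forall>i\<in>I. finite_sigma_group \<Sigma> (Q i)) \<and>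
        top_iso G (inverse_limit I R Q \<phi>) \<noteq> {})"

section \<open>Free pro-\<open>\<Sigma>\<close> products\<close>

text \<open>
  The test objects \<open>H\<close> of the coproduct property must range over a fixed type. A pro-\<open>\<Sigma>\<close> group
  topologically generated by images of \<open>A\<close> and \<open>B\<close> is a Hausdorff space with a dense subset
  of cardinality at most that of \<open>'a + 'b + nat\<close>, so it has at most as many elements as the type
  used below. That type thus contains a copy of \<open>A\<close>, of \<open>B\<close>, of \<open>F\<close> and of every pro-\<open>\<Sigma>\<close> group
  so generated, and in particular of all finite \<open>\<Sigma>\<close>-groups. Hence the property implies the same
  property for pro-\<open>\<Sigma>\<close> groups \<open>H\<close> over arbitrary types: existence by replacing \<open>H\<close> with the
  closed subgroup generated by the two images, uniqueness by mapping \<open>H\<close> to its finite quotients.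
  Homomorphisms out of \<open>F\<close> are taken in \<open>extensional (carrier F)\<close> because HOL functions are total.
\<close>

definition free_pro_sigma_product ::
  "nat set \<Rightarrow> 'a topgroup \<Rightarrow> 'b topgroup \<Rightarrow> 'c topgroup \<Rightarrow> ('a \<Rightarrow> 'c) \<Rightarrow> ('b \<Rightarrow> 'c) \<Rightarrow> bool" where
  "free_pro_sigma_product \<Sigma> A B F \<iota>\<^sub>A \<iota>\<^sub>B \<longleftrightarrow>
     pro_sigma_group \<Sigma> A \<and> pro_sigma_group \<Sigma> B \<and> pro_sigma_group \<Sigma> F \<and>
     \<iota>\<^sub>A \<in> cont_hom A F \<and> \<iota>\<^sub>B \<in> cont_hom B F \<and>
     (\<forall>(H :: ('a + 'b + 'c + nat) set set topgroup) f g.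
        pro_sigma_group \<Sigma> H \<and> f \<in> cont_hom A H \<and> g \<in> cont_hom B H \<longrightarrow>
        (\<exists>!h. h \<in> cont_hom F H \<and> h \<in> extensional (carrier F) \<and>
              (\<forall>a\<in>carrier A. h (\<iota>\<^sub>A a) = f a) \<and> (\<forall>b\<in>carrier B. h (\<iota>\<^sub>B b) = g b)))"

section \<open>Topological derived series\<close>

fun top_derived :: "'a topgroup \<Rightarrow> nat \<Rightarrow> 'a set" where
  "top_derived G 0 = carrier G"
| "top_derived G (Suc m) = gtop G closure_of (derived G (top_derived G m))"

definition solv_quotient :: "'a topgroup \<Rightarrow> nat \<Rightarrow> 'a set topgroup" where
  "solv_quotient G m = quotient_topgroup G (top_derived G m)"

definition solv_proj :: "'a topgroup \<Rightarrow> nat \<Rightarrow> 'a \<Rightarrow> 'a set" where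
  "solv_proj G m g = top_derived G m #>\<^bsub>G\<^esub> g"

end

theory Submission
  imports Defs "HOL-Number_Theory.Cong"
begin

text \<open>
  Let \<open>T = \<Omega>\<^bsup>[m-1]\<^esup>\<close> and let \<open>\<gamma>\<close> commute with \<open>x\<^sup>n\<close> modulo \<open>\<Omega>\<^bsup>[m]\<^esup>\<close>. By compactness it suffices
  that \<open>\<psi> \<gamma> \<in> A = \<langle>\<psi> x\<rangle>\<close> for every finite quotient \<open>\<psi> : \<Omega> \<rightarrow> Q\<close> that kills \<open>T\<close> and in which
  \<open>a = \<psi>(x\<^sup>n)\<close> is nontrivial. Choose a prime \<open>l\<close> dividing the order of \<open>a\<close>. As \<open>\<Omega>\<close> is a free product,
  there is a derivation \<open>D : \<Omega> \<rightarrow> \<int>/l[Q]\<close> with \<open>D = 0\<close> on \<open>C\<close> and \<open>D p = 1 - \<psi> p\<close> on \<open>P\<close>, and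
  \<open>(D, \<psi>)\<close> is a homomorphism into \<open>\<int>/l[Q] \<rtimes> Q\<close> killing \<open>\<Omega>\<^bsup>[m]\<^esup>\<close>. In \<open>\<int>/l[Q/A]\<close> the element \<open>D \<gamma>\<close>
  becomes \<open>A - (\<psi> \<gamma>)A\<close>, since this holds on \<open>C\<close> and on \<open>P\<close>. On the other hand \<open>a\<close> fixes \<open>D \<gamma>\<close>, so
  the coefficients of \<open>D \<gamma>\<close> on \<open>A\<close> are constant on the orbits of \<open>\<langle>a\<rangle>\<close> and their sum is \<open>0\<close>
  modulo \<open>l\<close>. Hence the coset \<open>A\<close> has coefficient \<open>0\<close> in \<open>A - (\<psi> \<gamma>)A\<close>, that is, \<open>\<psi> \<gamma> \<in> A\<close>.
\<close>

section \<open>Wreath products and lifts of a principal derivation\<close>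

text \<open>The semidirect product of the group ring \<open>Z/l[Q]\<close> by \<open>Q\<close>:
  \<open>f\<close> lists the coefficients of a group ring element, and \<open>q\<close> acts by left
  translation. Coefficients are residues in \<open>{0..<int l}\<close> and \<open>f\<close> is
  extensional, so every element has exactly one representation.\<close>

definition wreath :: "nat \<Rightarrow> 'b monoid \<Rightarrow> (('b \<Rightarrow> int) \<times> 'b) monoid" where
  "wreath l Q = \<lparr>carrier = (carrier Q \<rightarrow>\<^sub>E {0..<int l}) \<times> carrier Q,
     monoid.mult = (\<lambda>(f, q) (g, r). (\<lambda>y\<in>carrier Q. (f y + g (inv\<^bsub>Q\<^esub> q \<otimes>\<^bsub>Q\<^esub> y)) mod int l, q \<otimes>\<^bsub>Q\<^esub> r)),
     one = (\<lambda>y\<in>carrier Q. 0, \<one>\<^bsub>Q\<^esub>)\<rparr>"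

lemma carrier_wreath: "carrier (wreath l Q) = (carrier Q \<rightarrow>\<^sub>E {0..<int l}) \<times> carrier Q"
  and mult_wreath: "(f, q) \<otimes>\<^bsub>wreath l Q\<^esub> (g, r) =
    (\<lambda>y\<in>carrier Q. (f y + g (inv\<^bsub>Q\<^esub> q \<otimes>\<^bsub>Q\<^esub> y)) mod int l, q \<otimes>\<^bsub>Q\<^esub> r)"
  and one_wreath: "\<one>\<^bsub>wreath l Q\<^esub> = (\<lambda>y\<in>carrier Q. 0, \<one>\<^bsub>Q\<^esub>)"
  by (simp_all add: wreath_def)

lemma wreath_l_inv:
  assumes Q: "group Q" and "(f, q) \<in> carrier (wreath l Q)" and "l > 0"
  shows "(\<lambda>y\<in>carrier Q. (- f (q \<otimes>\<^bsub>Q\<^esub> y)) mod int l, inv\<^bsub>Q\<^esub> q) \<in> carrier (wreath l Q)"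
    and "(\<lambda>y\<in>carrier Q. (- f (q \<otimes>\<^bsub>Q\<^esub> y)) mod int l, inv\<^bsub>Q\<^esub> q) \<otimes>\<^bsub>wreath l Q\<^esub> (f, q) = \<one>\<^bsub>wreath l Q\<^esub>"
proof -
  interpret group Q by fact
  show "(\<lambda>y\<in>carrier Q. (- f (q \<otimes>\<^bsub>Q\<^esub> y)) mod int l, inv\<^bsub>Q\<^esub> q) \<in> carrier (wreath l Q)"
    using assms(2,3) by (auto simp: carrier_wreath)
  show "(\<lambda>y\<in>carrier Q. (- f (q \<otimes>\<^bsub>Q\<^esub> y)) mod int l, inv\<^bsub>Q\<^esub> q) \<otimes>\<^bsub>wreath l Q\<^esub> (f, q) = \<one>\<^bsub>wreath l Q\<^esub>"
    using assms(2) by (auto simp: carrier_wreath mult_wreath one_wreath mod_simps restrict_def)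
qed

lemma group_wreath:
  assumes Q: "group Q" and "l > 0"
  shows "group (wreath l Q)"
proof -
  interpret group Q by fact
  show ?thesis
  proof (rule groupI)
    fix x y assume xy: "x \<in> carrier (wreath l Q)" "y \<in> carrier (wreath l Q)"
    obtain f q where x: "x = (f, q)" by (cases x)
    obtain g r where y: "y = (g, r)" by (cases y)
    show "x \<otimes>\<^bsub>wreath l Q\<^esub> y \<in> carrier (wreath l Q)"
      using xy \<open>l > 0\<close> unfolding x y mult_wreath by (auto simp: carrier_wreath)
  next
    show "\<one>\<^bsub>wreath l Q\<^esub> \<in> carrier (wreath l Q)"
      using \<open>l > 0\<close> by (auto simp: carrier_wreath one_wreath)
  next
    fix x y z assume xyz: "x \<in> carrier (wreath l Q)" "y \<in> carrier (wreath l Q)" "z \<in> carrier (wreath l Q)"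
    obtain f q where x: "x = (f, q)" by (cases x)
    obtain g r where y: "y = (g, r)" by (cases y)
    obtain h s where z: "z = (h, s)" by (cases z)
    have c: "q \<in> carrier Q" "r \<in> carrier Q" "s \<in> carrier Q"
      using xyz by (auto simp: carrier_wreath x y z)
    show "x \<otimes>\<^bsub>wreath l Q\<^esub> y \<otimes>\<^bsub>wreath l Q\<^esub> z = x \<otimes>\<^bsub>wreath l Q\<^esub> (y \<otimes>\<^bsub>wreath l Q\<^esub> z)"
      unfolding x y z mult_wreath using c
      by (auto simp: inv_mult_group m_assoc mod_simps add.assoc intro!: restrict_ext)
  next
    fix x assume x0: "x \<in> carrier (wreath l Q)"
    obtain f q where x: "x = (f, q)" by (cases x)
    have f: "f \<in> carrier Q \<rightarrow>\<^sub>E {0..<int l}" and q: "q \<in> carrier Q"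
      using x0 by (auto simp: x carrier_wreath)
    have "(\<lambda>y\<in>carrier Q. f y mod int l) = f"
      using f by (intro extensionalityI[of _ "carrier Q"]) (auto simp: PiE_iff)
    then show "\<one>\<^bsub>wreath l Q\<^esub> \<otimes>\<^bsub>wreath l Q\<^esub> x = x"
      using q by (simp add: x one_wreath mult_wreath cong: restrict_cong)
    show "\<exists>y\<in>carrier (wreath l Q). y \<otimes>\<^bsub>wreath l Q\<^esub> x = \<one>\<^bsub>wreath l Q\<^esub>"
      using wreath_l_inv[OF Q _ \<open>l > 0\<close>] x0 unfolding x by blast
  qed
qed

section \<open>Coset sums and the group of derivation lifts\<close>

lemma (in group) mem_l_coset_iff:
  assumes "A \<subseteq> carrier G" "t \<in> carrier G" "y \<in> carrier G"
  shows "y \<in> t <# A \<longleftrightarrow> inv t \<otimes> y \<in> A"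
proof
  assume "inv t \<otimes> y \<in> A"
  then show "y \<in> t <# A"
    using assms by (force simp: l_coset_def m_assoc[symmetric])
qed (use assms in \<open>auto simp: l_coset_def m_assoc[symmetric] subset_iff\<close>)

text \<open>Left translation by \<open>q\<close> carries the coset of \<open>t\<close> bijectively
  onto that of \<open>q \<otimes> t\<close>. On coset sums this is the action of \<open>Q\<close> on
  \<open>Z/l[Q/A]\<close>.\<close>

lemma (in group) sum_l_coset_shift:
  assumes "A \<subseteq> carrier G" "t \<in> carrier G" "q \<in> carrier G"
  shows "(\<Sum>y\<in>t <# A. f (q \<otimes> y)) = (\<Sum>y\<in>(q \<otimes> t) <# A. f y)"
proof (rule sum.reindex_bij_betw)
  have "(q \<otimes> t) <# A = (\<lambda>y. q \<otimes> y) ` (t <# A)"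
    using assms by (auto simp: l_coset_def m_assoc subset_iff image_iff)
  moreover have "inj_on (\<lambda>y. q \<otimes> y) (t <# A)"
    using assms(3) l_coset_subset_G[OF assms(1,2)] by (intro inj_onI) (metis Units_eq Units_l_cancel subsetD)
  ultimately show "bij_betw (\<lambda>y. q \<otimes> y) (t <# A) ((q \<otimes> t) <# A)"
    by (simp add: bij_betw_def)
qed

text \<open>In terms of \<open>M = \<int>/l[Q/A]\<close>: \<open>f\<close> represents an element of \<open>\<int>/l[Q]\<close> whose image in \<open>M\<close>
  is \<open>A - qA\<close>, so that the pair \<open>(f, q)\<close> lifts the value at \<open>q\<close> of the principal derivation of \<open>M\<close>.\<close>
definition derivation_lifts :: "nat \<Rightarrow> 'b monoid \<Rightarrow> 'b set \<Rightarrow> (('b \<Rightarrow> int) \<times> 'b) set" where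
  "derivation_lifts l Q A = {(f, q) \<in> carrier (wreath l Q). \<forall>t\<in>carrier Q.
     [(\<Sum>y\<in>t <#\<^bsub>Q\<^esub> A. f y) = of_bool (\<one>\<^bsub>Q\<^esub> \<in> t <#\<^bsub>Q\<^esub> A) - of_bool (q \<in> t <#\<^bsub>Q\<^esub> A)] (mod int l)}"

text \<open>Sending \<open>q\<close> to \<open>A - qA\<close> is a derivation: its value at
  \<open>q \<otimes> r\<close> is the value at \<open>q\<close> plus the translate by
  \<open>q\<close> of the value at \<open>r\<close>. Coset sums are additive and compatible with
  translation, so lifts of these values are closed under products and inverses.\<close>

lemma subgroup_derivation_lifts:
  assumes Q: "group Q" and "l > 0" and A: "A \<subseteq> carrier Q"
  shows "subgroup (derivation_lifts l Q A) (wreath l Q)"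
proof -
  interpret group Q by fact
  interpret W: group "wreath l Q" using group_wreath assms by blast
  show ?thesis
  proof (rule W.subgroupI)
    show "derivation_lifts l Q A \<subseteq> carrier (wreath l Q)"
      by (auto simp: derivation_lifts_def)
    have "\<one>\<^bsub>wreath l Q\<^esub> \<in> derivation_lifts l Q A"
      using W.one_closed l_coset_subset_G[OF A]
      by (auto simp: derivation_lifts_def one_wreath subset_iff)
    then show "derivation_lifts l Q A \<noteq> {}" by blast
  next
    fix x assume x0: "x \<in> derivation_lifts l Q A"
    obtain f q where x: "x = (f, q)" by (cases x)
    have xW: "(f, q) \<in> carrier (wreath l Q)" and q: "q \<in> carrier Q"
      and S: "\<And>t. t \<in> carrier Q \<Longrightarrow>
        [(\<Sum>y\<in>t <#\<^bsub>Q\<^esub> A. f y) = of_bool (\<one>\<^bsub>Q\<^esub> \<in> t <#\<^bsub>Q\<^esub> A) - of_bool (q \<in> t <#\<^bsub>Q\<^esub> A)] (mod int l)"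
      using x0 by (auto simp: derivation_lifts_def x carrier_wreath)
    let ?f = "\<lambda>y\<in>carrier Q. (- f (q \<otimes>\<^bsub>Q\<^esub> y)) mod int l"
    have "inv\<^bsub>wreath l Q\<^esub> x = (?f, inv\<^bsub>Q\<^esub> q)"
      unfolding x by (rule W.inv_equality[OF wreath_l_inv(2) xW wreath_l_inv(1)]) (use Q xW \<open>l > 0\<close> in auto)
    moreover have "[(\<Sum>y\<in>t <#\<^bsub>Q\<^esub> A. ?f y) = of_bool (\<one>\<^bsub>Q\<^esub> \<in> t <#\<^bsub>Q\<^esub> A) - of_bool (inv\<^bsub>Q\<^esub> q \<in> t <#\<^bsub>Q\<^esub> A)] (mod int l)"
      if t: "t \<in> carrier Q" for t
    proof -
      have "[(\<Sum>y\<in>t <#\<^bsub>Q\<^esub> A. ?f y) = (\<Sum>y\<in>t <#\<^bsub>Q\<^esub> A. - f (q \<otimes>\<^bsub>Q\<^esub> y))] (mod int l)"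
        using l_coset_subset_G[OF A t] by (intro cong_sum) (auto simp: cong_def)
      also have "(\<Sum>y\<in>t <#\<^bsub>Q\<^esub> A. - f (q \<otimes>\<^bsub>Q\<^esub> y)) = - (\<Sum>y\<in>(q \<otimes>\<^bsub>Q\<^esub> t) <#\<^bsub>Q\<^esub> A. f y)"
        using sum_l_coset_shift[OF A t q, of f] by (simp add: sum_negf)
      \<comment> \<open>The hypothesis on \<open>f\<close> is applied to the coset of
        \<open>q \<otimes> t\<close>, which contains \<open>q\<close> iff the coset of
        \<open>t\<close> contains \<open>\<one>\<close>.\<close>
      also have "[\<dots> = - (of_bool (\<one>\<^bsub>Q\<^esub> \<in> (q \<otimes>\<^bsub>Q\<^esub> t) <#\<^bsub>Q\<^esub> A) - of_bool (q \<in> (q \<otimes>\<^bsub>Q\<^esub> t) <#\<^bsub>Q\<^esub> A))] (mod int l)"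
        unfolding cong_minus_minus_iff using q t by (intro S) auto
      also have "- (of_bool (\<one>\<^bsub>Q\<^esub> \<in> (q \<otimes>\<^bsub>Q\<^esub> t) <#\<^bsub>Q\<^esub> A) - of_bool (q \<in> (q \<otimes>\<^bsub>Q\<^esub> t) <#\<^bsub>Q\<^esub> A))
        = (of_bool (\<one>\<^bsub>Q\<^esub> \<in> t <#\<^bsub>Q\<^esub> A) - of_bool (inv\<^bsub>Q\<^esub> q \<in> t <#\<^bsub>Q\<^esub> A) :: int)"
        using q t A by (simp add: mem_l_coset_iff inv_mult_group m_assoc)
      finally show ?thesis .
    qed
    ultimately show "inv\<^bsub>wreath l Q\<^esub> x \<in> derivation_lifts l Q A"
      using W.inv_closed[OF xW] by (simp add: derivation_lifts_def x)
  next
    fix x y assume xy: "x \<in> derivation_lifts l Q A" "y \<in> derivation_lifts l Q A"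
    obtain f q where x: "x = (f, q)" by (cases x)
    obtain g r where y: "y = (g, r)" by (cases y)
    have xW: "(f, q) \<in> carrier (wreath l Q)" and q: "q \<in> carrier Q"
      and S: "\<And>t. t \<in> carrier Q \<Longrightarrow>
        [(\<Sum>y\<in>t <#\<^bsub>Q\<^esub> A. f y) = of_bool (\<one>\<^bsub>Q\<^esub> \<in> t <#\<^bsub>Q\<^esub> A) - of_bool (q \<in> t <#\<^bsub>Q\<^esub> A)] (mod int l)"
      using xy by (auto simp: derivation_lifts_def x carrier_wreath)
    have yW: "(g, r) \<in> carrier (wreath l Q)" and r: "r \<in> carrier Q"
      and T: "\<And>t. t \<in> carrier Q \<Longrightarrow>
        [(\<Sum>y\<in>t <#\<^bsub>Q\<^esub> A. g y) = of_bool (\<one>\<^bsub>Q\<^esub> \<in> t <#\<^bsub>Q\<^esub> A) - of_bool (r \<in> t <#\<^bsub>Q\<^esub> A)] (mod int l)"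
      using xy by (auto simp: derivation_lifts_def y carrier_wreath)
    let ?f = "\<lambda>y\<in>carrier Q. (f y + g (inv\<^bsub>Q\<^esub> q \<otimes>\<^bsub>Q\<^esub> y)) mod int l"
    have "[(\<Sum>y\<in>t <#\<^bsub>Q\<^esub> A. ?f y) = of_bool (\<one>\<^bsub>Q\<^esub> \<in> t <#\<^bsub>Q\<^esub> A) - of_bool (q \<otimes>\<^bsub>Q\<^esub> r \<in> t <#\<^bsub>Q\<^esub> A)] (mod int l)"
      if t: "t \<in> carrier Q" for t
    proof -
      let ?u = "inv\<^bsub>Q\<^esub> q \<otimes>\<^bsub>Q\<^esub> t"
      have "[(\<Sum>y\<in>t <#\<^bsub>Q\<^esub> A. ?f y) = (\<Sum>y\<in>t <#\<^bsub>Q\<^esub> A. f y + g (inv\<^bsub>Q\<^esub> q \<otimes>\<^bsub>Q\<^esub> y))] (mod int l)"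
        using l_coset_subset_G[OF A t] by (intro cong_sum) (auto simp: cong_def)
      also have "(\<Sum>y\<in>t <#\<^bsub>Q\<^esub> A. f y + g (inv\<^bsub>Q\<^esub> q \<otimes>\<^bsub>Q\<^esub> y)) = (\<Sum>y\<in>t <#\<^bsub>Q\<^esub> A. f y) + (\<Sum>y\<in>?u <#\<^bsub>Q\<^esub> A. g y)"
        using sum_l_coset_shift[OF A t, of "inv\<^bsub>Q\<^esub> q" g] q by (simp add: sum.distrib)
      also have "[\<dots> = (of_bool (\<one>\<^bsub>Q\<^esub> \<in> t <#\<^bsub>Q\<^esub> A) - of_bool (q \<in> t <#\<^bsub>Q\<^esub> A))
          + (of_bool (\<one>\<^bsub>Q\<^esub> \<in> ?u <#\<^bsub>Q\<^esub> A) - of_bool (r \<in> ?u <#\<^bsub>Q\<^esub> A))] (mod int l)"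
        using q t by (intro cong_add S T) auto
      \<comment> \<open>The sum telescopes: the coset of \<open>?u\<close> contains
        \<open>\<one>\<close> iff that of \<open>t\<close> contains \<open>q\<close>, and it
        contains \<open>r\<close> iff that of \<open>t\<close> contains
        \<open>q \<otimes> r\<close>.\<close>
      also have "(of_bool (\<one>\<^bsub>Q\<^esub> \<in> t <#\<^bsub>Q\<^esub> A) - of_bool (q \<in> t <#\<^bsub>Q\<^esub> A))
          + (of_bool (\<one>\<^bsub>Q\<^esub> \<in> ?u <#\<^bsub>Q\<^esub> A) - of_bool (r \<in> ?u <#\<^bsub>Q\<^esub> A))
        = (of_bool (\<one>\<^bsub>Q\<^esub> \<in> t <#\<^bsub>Q\<^esub> A) - of_bool (q \<otimes>\<^bsub>Q\<^esub> r \<in> t <#\<^bsub>Q\<^esub> A) :: int)"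
        using q r t A by (simp add: mem_l_coset_iff inv_mult_group m_assoc)
      finally show ?thesis .
    qed
    moreover have "(f, q) \<otimes>\<^bsub>wreath l Q\<^esub> (g, r) \<in> carrier (wreath l Q)" using xW yW by blast
    ultimately show "x \<otimes>\<^bsub>wreath l Q\<^esub> y \<in> derivation_lifts l Q A"
      unfolding x y mult_wreath by (simp add: derivation_lifts_def)
  qed
qed

text \<open>For \<open>a\<close> in the subgroup \<open>A\<close> one has \<open>A - aA = 0\<close>,
  which the zero function lifts. This allows \<open>D = 0\<close> on the procyclic factor.\<close>

lemma zero_in_derivation_lifts:
  assumes Q: "group Q" and "l > 0" and A: "subgroup A Q" and a: "a \<in> A"
  shows "(\<lambda>y\<in>carrier Q. 0, a) \<in> derivation_lifts l Q A"
proof -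
  interpret group Q by fact
  interpret A: subgroup A Q by fact
  have "(\<Sum>y\<in>t <#\<^bsub>Q\<^esub> A. (\<lambda>y\<in>carrier Q. 0) y) = (0::int)" if "t \<in> carrier Q" for t
    using l_coset_subset_G[OF A.subset that] by (auto intro!: sum.neutral)
  moreover have "\<one>\<^bsub>Q\<^esub> \<in> t <#\<^bsub>Q\<^esub> A \<longleftrightarrow> a \<in> t <#\<^bsub>Q\<^esub> A" if "t \<in> carrier Q" for t
  proof -
    have "inv\<^bsub>Q\<^esub> t \<otimes>\<^bsub>Q\<^esub> a \<in> A \<longleftrightarrow> inv\<^bsub>Q\<^esub> t \<in> A"
      using that a A.subset subgroup_mult_id A.m_closed A.m_inv_closed
      by (metis A.mem_carrier inv_closed inv_solve_right)
    then show ?thesis using that a by (simp add: mem_l_coset_iff A.subset)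
  qed
  ultimately show ?thesis
    using a \<open>l > 0\<close> by (auto simp: derivation_lifts_def carrier_wreath)
qed

text \<open>The element \<open>1 - q\<close> of \<open>Z/l[Q]\<close>, which is the value at
  \<open>q\<close> of a principal derivation of the group ring itself.\<close>

definition point_mass :: "nat \<Rightarrow> 'b monoid \<Rightarrow> 'b \<Rightarrow> 'b \<Rightarrow> int" where
  "point_mass l Q q = (\<lambda>y\<in>carrier Q. (of_bool (y = \<one>\<^bsub>Q\<^esub>) - of_bool (y = q)) mod int l)"

text \<open>Summing over a coset records whether it contains \<open>\<one>\<close> and whether it
  contains \<open>q\<close>. Finiteness matters because a sum over an infinite set is
  \<open>0\<close> by convention.\<close>

lemma point_mass_in_derivation_lifts:
  assumes Q: "group Q" and "finite (carrier Q)" and "l > 0" and A: "A \<subseteq> carrier Q" and q: "q \<in> carrier Q"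
  shows "(point_mass l Q q, q) \<in> derivation_lifts l Q A"
proof -
  interpret group Q by fact
  have "[(\<Sum>y\<in>t <#\<^bsub>Q\<^esub> A. point_mass l Q q y) =
      of_bool (\<one>\<^bsub>Q\<^esub> \<in> t <#\<^bsub>Q\<^esub> A) - of_bool (q \<in> t <#\<^bsub>Q\<^esub> A)] (mod int l)" if t: "t \<in> carrier Q" for t
  proof -
    have sub: "t <#\<^bsub>Q\<^esub> A \<subseteq> carrier Q" by (rule l_coset_subset_G[OF A t])
    have "finite (t <#\<^bsub>Q\<^esub> A)" using sub assms(2) finite_subset by blast
    then have "(\<Sum>y\<in>t <#\<^bsub>Q\<^esub> A. of_bool (y = \<one>\<^bsub>Q\<^esub>) - of_bool (y = q)) =
      (of_bool (\<one>\<^bsub>Q\<^esub> \<in> t <#\<^bsub>Q\<^esub> A) - of_bool (q \<in> t <#\<^bsub>Q\<^esub> A) :: int)"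
      by (auto simp: sum_subtractf of_bool_def)
    moreover have "[(\<Sum>y\<in>t <#\<^bsub>Q\<^esub> A. point_mass l Q q y) =
        (\<Sum>y\<in>t <#\<^bsub>Q\<^esub> A. of_bool (y = \<one>\<^bsub>Q\<^esub>) - of_bool (y = q))] (mod int l)"
      using sub by (intro cong_sum) (auto simp: cong_def point_mass_def)
    ultimately show ?thesis by simp
  qed
  then show ?thesis
    using q \<open>l > 0\<close> by (auto simp: derivation_lifts_def carrier_wreath point_mass_def)
qed

text \<open>The identity \<open>1 - qr = (1 - q) + q(1 - r)\<close>. It makes
  \<open>q \<mapsto> (1 - q, q)\<close> a homomorphism, to be used on the factor
  \<open>P\<close>.\<close>

lemma point_mass_mult:
  assumes Q: "group Q" and q: "q \<in> carrier Q" and r: "r \<in> carrier Q"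
  shows "(point_mass l Q q, q) \<otimes>\<^bsub>wreath l Q\<^esub> (point_mass l Q r, r) =
    (point_mass l Q (q \<otimes>\<^bsub>Q\<^esub> r), q \<otimes>\<^bsub>Q\<^esub> r)"
proof -
  interpret group Q by fact
  have 1: "inv\<^bsub>Q\<^esub> q \<otimes>\<^bsub>Q\<^esub> y = \<one>\<^bsub>Q\<^esub> \<longleftrightarrow> y = q" "inv\<^bsub>Q\<^esub> q \<otimes>\<^bsub>Q\<^esub> y = r \<longleftrightarrow> y = q \<otimes>\<^bsub>Q\<^esub> r"
    if "y \<in> carrier Q" for y
    using q r that by (metis inv_solve_left inv_closed inv_inv one_closed r_one)+
  show ?thesis
    unfolding mult_wreath point_mass_def using q r
    by (auto intro!: restrict_ext simp: mod_simps 1)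
qed

text \<open>The group \<open>H\<close> permutes \<open>A\<close> freely, so each value of \<open>f\<close> on \<open>A\<close> is taken a multiple of
  \<open>card H\<close> times.\<close>
lemma (in group) card_dvd_sum_invariant:
  fixes f :: "'a \<Rightarrow> int"
  assumes A: "subgroup A G" "finite A" and H: "subgroup H G" "H \<subseteq> A"
    and f: "\<And>h y. h \<in> H \<Longrightarrow> y \<in> A \<Longrightarrow> f (h \<otimes> y) = f y"
  shows "int (card H) dvd (\<Sum>y\<in>A. f y)"
proof -
  interpret A: group "G\<lparr>carrier := A\<rparr>" using A(1) by (rule subgroup_imp_group)
  have H': "subgroup H (G\<lparr>carrier := A\<rparr>)" using subgroup_incl H A by blast
  let ?R = "rcosets\<^bsub>G\<lparr>carrier := A\<rparr>\<^esub> H"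
  have U: "\<Union>?R = A" using A.rcosets_part_G[OF H'] by simp
  have "\<forall>B\<in>?R. finite B" using U A(2) by (auto intro: finite_subset[of _ A])
  moreover have "\<forall>B\<in>?R. \<forall>C\<in>?R. B \<noteq> C \<longrightarrow> B \<inter> C = {}"
    using A.rcos_disjoint[OF H'] by (simp add: pairwise_def disjnt_def)
  ultimately have "sum f (\<Union>?R) = (\<Sum>R\<in>?R. \<Sum>y\<in>R. f y)"
    using sum.Union_disjoint[of ?R f] by (simp add: comp_def)
  then have "(\<Sum>y\<in>A. f y) = (\<Sum>R\<in>?R. \<Sum>y\<in>R. f y)"
    by (simp only: U)
  also have "int (card H) dvd \<dots>"
  proof (rule dvd_sum)
    fix R assume R: "R \<in> ?R"
    then obtain y where y: "y \<in> A" "R = H #> y" by (auto simp: RCOSETS_def)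
    have "(\<Sum>z\<in>R. f z) = (\<Sum>z\<in>R. f y)"
      using y f by (intro sum.cong) (auto simp: r_coset_def)
    also have "\<dots> = int (card H) * f y"
      using A.card_rcosets_equal[OF R] H(2) by simp
    finally show "int (card H) dvd (\<Sum>z\<in>R. f z)" by simp
  qed
  finally show ?thesis .
qed

text \<open>Commuting with \<open>(0, a)\<close> makes \<open>f\<close> invariant under
  \<open>a\<close>, so its sum over \<open>A\<close> is divisible by the order of \<open>a\<close>,
  hence by \<open>l\<close>. For \<open>q\<close> outside \<open>A\<close> the lifting condition
  would make this sum \<open>1\<close> modulo \<open>l\<close>.\<close>

lemma derivation_lifts_commute:
  assumes Q: "group Q" and fin: "finite (carrier Q)" and A: "subgroup A Q" and a: "a \<in> A"
    and l: "prime l" "l dvd card (generate Q {a})"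
    and fq: "(f, q) \<in> derivation_lifts l Q A"
    and comm: "(f, q) \<otimes>\<^bsub>wreath l Q\<^esub> (\<lambda>y\<in>carrier Q. 0, a) = (\<lambda>y\<in>carrier Q. 0, a) \<otimes>\<^bsub>wreath l Q\<^esub> (f, q)"
  shows "q \<in> A"
proof (rule ccontr)
  assume "q \<notin> A"
  interpret group Q by fact
  interpret A: subgroup A Q by fact
  have aQ: "a \<in> carrier Q" and q: "q \<in> carrier Q" and f: "f \<in> carrier Q \<rightarrow>\<^sub>E {0..<int l}"
    using a fq by (auto simp: derivation_lifts_def carrier_wreath)
  have inv: "f (inv\<^bsub>Q\<^esub> a \<otimes>\<^bsub>Q\<^esub> y) = f y" if y: "y \<in> carrier Q" for y
  proof -
    \<comment> \<open>Multiplication by \<open>(0, a)\<close> on the right leaves \<open>f\<close>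
      alone, on the left it translates \<open>f\<close> by \<open>a\<close>. Since all values are
      reduced, congruence gives equality.\<close>
    have "(f y + 0) mod int l = (0 + f (inv\<^bsub>Q\<^esub> a \<otimes>\<^bsub>Q\<^esub> y)) mod int l"
      using comm y aQ q unfolding mult_wreath by (auto dest!: fun_cong[where x=y])
    moreover have "f y \<in> {0..<int l}" "f (inv\<^bsub>Q\<^esub> a \<otimes>\<^bsub>Q\<^esub> y) \<in> {0..<int l}" using f y aQ by auto
    ultimately show ?thesis by simp
  qed
  have "\<forall>y\<in>carrier Q. f (h \<otimes>\<^bsub>Q\<^esub> y) = f y" if "h \<in> generate Q {a}" for h
    using that
  proof induction
    case (incl h)
    then show ?case using inv aQ by (metis inv_closed inv_inv inv_solve_left m_closed singletonD)
  next
    case (eng h1 h2)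
    then have "h1 \<in> carrier Q" "h2 \<in> carrier Q" using generate_in_carrier[of "{a}"] aQ by auto
    with eng show ?case by (simp add: m_assoc)
  qed (use inv in auto)
  then have "int (card (generate Q {a})) dvd (\<Sum>y\<in>A. f y)"
    using A a A.subset fin finite_subset aQ
    by (intro card_dvd_sum_invariant generate_is_subgroup generate_subgroup_incl) (auto simp: A.mem_carrier)
  then have "int l dvd (\<Sum>y\<in>A. f y)" using l(2) by (meson dvd_trans int_dvd_int_iff)
  \<comment> \<open>The choice \<open>t = \<one>\<close> selects the coset \<open>A\<close>
    itself.\<close>
  moreover have "[(\<Sum>y\<in>\<one>\<^bsub>Q\<^esub> <#\<^bsub>Q\<^esub> A. f y) = of_bool (\<one>\<^bsub>Q\<^esub> \<in> \<one>\<^bsub>Q\<^esub> <#\<^bsub>Q\<^esub> A) - of_bool (q \<in> \<one>\<^bsub>Q\<^esub> <#\<^bsub>Q\<^esub> A)] (mod int l)"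
    using fq one_closed by (auto simp: derivation_lifts_def)
  ultimately have "[0 = 1] (mod int l)"
    using \<open>q \<notin> A\<close> by (simp add: lcos_mult_one[OF A.subset] cong_0_iff[symmetric] cong_def)
  then show False using l(1) by (auto simp: cong_def dvd_eq_mod_eq_0[symmetric] dest: not_prime_unit)
qed

section \<open>Closed subgroups and continuous homomorphisms\<close>

lemma topological_groupD:
  assumes "topological_group G"
  shows "group G" "topspace (gtop G) = carrier G"
  using assms by (auto simp: topological_group_def)

lemma continuous_map_group_mult:
  assumes G: "topological_group G"
    and "continuous_map X (gtop G) f" "continuous_map X (gtop G) g"
  shows "continuous_map X (gtop G) (\<lambda>x. f x \<otimes>\<^bsub>G\<^esub> g x)"
proof -
  have "continuous_map (prod_topology (gtop G) (gtop G)) (gtop G) (\<lambda>(a, b). a \<otimes>\<^bsub>G\<^esub> b)"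
    using G by (simp add: topological_group_def)
  from continuous_map_compose[OF continuous_map_pairedI[OF assms(2,3)] this] show ?thesis
    by (simp add: comp_def)
qed

lemma closure_of_subgroup:
  assumes G: "topological_group G" and H: "subgroup H G"
  shows "subgroup (gtop G closure_of H) G"
proof -
  interpret group G using G by (rule topological_groupD)
  interpret H: subgroup H G by fact
  note [simp] = topological_groupD(2)[OF G]
  show ?thesis
  proof (rule subgroupI)
    show "gtop G closure_of H \<subseteq> carrier G"
      using closure_of_subset_topspace[of "gtop G" H] by simp
    have "H \<subseteq> gtop G closure_of H" by (simp add: H.subset closure_of_subset)
    then show "gtop G closure_of H \<noteq> {}" using H.one_closed by blast
  next
    fix a assume a: "a \<in> gtop G closure_of H"
    have "continuous_map (gtop G) (gtop G) (\<lambda>a. inv\<^bsub>G\<^esub> a)" using G by (simp add: topological_group_def)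
    from continuous_map_image_closure_subset[OF this, of H] a
    have "inv\<^bsub>G\<^esub> a \<in> gtop G closure_of ((\<lambda>a. inv\<^bsub>G\<^esub> a) ` H)" by blast
    then show "inv\<^bsub>G\<^esub> a \<in> gtop G closure_of H"
      using closure_of_mono[of "(\<lambda>a. inv\<^bsub>G\<^esub> a) ` H" H "gtop G"] by auto
  next
    fix a b assume ab: "a \<in> gtop G closure_of H" "b \<in> gtop G closure_of H"
    have "continuous_map (prod_topology (gtop G) (gtop G)) (gtop G) (\<lambda>(a, b). a \<otimes>\<^bsub>G\<^esub> b)"
      using G by (simp add: topological_group_def)
    \<comment> \<open>The closure of \<open>H \<times> H\<close> is the product of the closures, so
      joint continuity treats both factors at once.\<close>
    from continuous_map_image_closure_subset[OF this, of "H \<times> H"] ab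
    have "a \<otimes>\<^bsub>G\<^esub> b \<in> gtop G closure_of ((\<lambda>(a, b). a \<otimes>\<^bsub>G\<^esub> b) ` (H \<times> H))"
      unfolding closure_of_Times by force
    moreover have "(\<lambda>(a, b). a \<otimes>\<^bsub>G\<^esub> b) ` (H \<times> H) \<subseteq> H" by auto
    ultimately show "a \<otimes>\<^bsub>G\<^esub> b \<in> gtop G closure_of H"
      using closure_of_mono by blast
  qed
qed

lemma closure_of_normal:
  assumes G: "topological_group G" and N: "N \<lhd> G"
  shows "gtop G closure_of N \<lhd> G"
proof -
  interpret group G using G by (rule topological_groupD)
  interpret N: normal N G by fact
  show ?thesis
  proof (rule normal_invI[OF closure_of_subgroup[OF G N.subgroup_axioms]])
    fix g a assume g: "g \<in> carrier G" and a: "a \<in> gtop G closure_of N"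
    have "continuous_map (gtop G) (gtop G) (\<lambda>a. g \<otimes>\<^bsub>G\<^esub> a \<otimes>\<^bsub>G\<^esub> inv\<^bsub>G\<^esub> g)"
      by (rule continuous_map_group_mult[OF G continuous_map_group_mult[OF G]])
        (simp_all add: g topological_groupD(2)[OF G] continuous_map_id[unfolded id_def])
    from continuous_map_image_closure_subset[OF this, of N] a
    have "g \<otimes>\<^bsub>G\<^esub> a \<otimes>\<^bsub>G\<^esub> inv\<^bsub>G\<^esub> g \<in> gtop G closure_of ((\<lambda>a. g \<otimes>\<^bsub>G\<^esub> a \<otimes>\<^bsub>G\<^esub> inv\<^bsub>G\<^esub> g) ` N)"
      by blast
    moreover have "(\<lambda>a. g \<otimes>\<^bsub>G\<^esub> a \<otimes>\<^bsub>G\<^esub> inv\<^bsub>G\<^esub> g) ` N \<subseteq> N" using g N.inv_op_closed2 by auto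
    ultimately show "g \<otimes>\<^bsub>G\<^esub> a \<otimes>\<^bsub>G\<^esub> inv\<^bsub>G\<^esub> g \<in> gtop G closure_of N"
      using closure_of_mono by blast
  qed
qed

lemma top_derived_normal:
  assumes "topological_group G"
  shows "top_derived G k \<lhd> G"
proof -
  interpret group G using assms by (rule topological_groupD)
  show ?thesis
    by (induction k) (use normal_self closure_of_normal[OF assms] derived_is_normal in auto)
qed

lemma top_derived_subset: "topological_group G \<Longrightarrow> top_derived G k \<subseteq> carrier G"
  using top_derived_normal normal_imp_subgroup subgroup.subset by metis

text \<open>Continuous maps send closures into closures, and homomorphisms preserve commutator
  subgroups. The target is only asked to be a group, which is what
  \<open>group_quotient_topgroup\<close> supplies for a quotient.\<close>

lemma cont_hom_top_derived:
  assumes "group G" "group H" and h: "h \<in> cont_hom G H" and "\<And>k. top_derived G k \<subseteq> carrier G"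
  shows "h ` top_derived G k \<subseteq> top_derived H k"
proof -
  interpret group_hom G H h
    using assms by (auto simp: cont_hom_def group_hom_def group_hom_axioms_def)
  show ?thesis
  proof (induction k)
    case 0
    then show ?case by auto
  next
    case (Suc k)
    have "h ` top_derived G (Suc k) \<subseteq> gtop H closure_of (h ` derived G (top_derived G k))"
      using h by (simp add: cont_hom_def continuous_map_image_closure_subset)
    also have "h ` derived G (top_derived G k) = derived H (h ` top_derived G k)"
      using assms(4) by (simp add: derived_img)
    also have "gtop H closure_of \<dots> \<subseteq> top_derived H (Suc k)"
      using Suc.IH by (simp add: closure_of_mono H.mono_derived)
    finally show ?case .
  qed
qed

section \<open>Quotient groups with the quotient topology\<close>

lemma quotient_topgroup_simps [simp]:
  "carrier (quotient_topgroup G N) = carrier (G Mod N)"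
  "monoid.mult (quotient_topgroup G N) = set_mult G"
  "\<one>\<^bsub>quotient_topgroup G N\<^esub> = N"
  by (simp_all add: quotient_topgroup_def monoid.defs)

text \<open>The two records have the same operations but different types, so the axioms are carried
  over from \<open>G Mod N\<close> one by one.\<close>

lemma group_quotient_topgroup:
  assumes "N \<lhd> G"
  shows "group (quotient_topgroup G N)"
proof -
  interpret Q: group "G Mod N" using assms by (rule normal.factorgroup_is_group)
  show ?thesis
  proof (rule groupI)
    fix A B assume "A \<in> carrier (quotient_topgroup G N)" "B \<in> carrier (quotient_topgroup G N)"
    then show "A \<otimes>\<^bsub>quotient_topgroup G N\<^esub> B \<in> carrier (quotient_topgroup G N)"
      using Q.m_closed by simp
  next
    fix A B C assume "A \<in> carrier (quotient_topgroup G N)" "B \<in> carrier (quotient_topgroup G N)"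
      "C \<in> carrier (quotient_topgroup G N)"
    then show "A \<otimes>\<^bsub>quotient_topgroup G N\<^esub> B \<otimes>\<^bsub>quotient_topgroup G N\<^esub> C
        = A \<otimes>\<^bsub>quotient_topgroup G N\<^esub> (B \<otimes>\<^bsub>quotient_topgroup G N\<^esub> C)"
      using Q.m_assoc by simp
  next
    fix A assume "A \<in> carrier (quotient_topgroup G N)"
    then show "\<one>\<^bsub>quotient_topgroup G N\<^esub> \<otimes>\<^bsub>quotient_topgroup G N\<^esub> A = A"
      "\<exists>B\<in>carrier (quotient_topgroup G N). B \<otimes>\<^bsub>quotient_topgroup G N\<^esub> A = \<one>\<^bsub>quotient_topgroup G N\<^esub>"
      using Q.l_one Q.l_inv_ex by auto
  qed (use Q.one_closed in simp)
qed

lemma quotient_topgroup_proj: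
  assumes G: "topological_group G" and N: "N \<lhd> G"
  shows "(\<lambda>g. N #>\<^bsub>G\<^esub> g) \<in> cont_hom G (quotient_topgroup G N)"
proof -
  interpret normal N G by fact
  note op = openin_quotient_topgroup[OF G subgroup_axioms]
  have un: "\<Union> (carrier (G Mod N)) = carrier G"
    using rcosets_part_G[OF subgroup_axioms] by (simp add: FactGroup_def)
  have "openin (gtop (quotient_topgroup G N)) (carrier (G Mod N))"
    unfolding op un using topological_groupD(2)[OF G] by (metis openin_topspace subset_refl)
  then have top: "topspace (gtop (quotient_topgroup G N)) = carrier (G Mod N)"
    using op by (meson openin_subset openin_topspace subset_antisym)
  have "openin (gtop G) {g \<in> carrier G. N #>\<^bsub>G\<^esub> g \<in> \<U>}"
    if "openin (gtop (quotient_topgroup G N)) \<U>" for \<U>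
  proof -
    from that have U: "\<U> \<subseteq> carrier (G Mod N)" "openin (gtop G) (\<Union>\<U>)" by (simp_all add: op)
    \<comment> \<open>Each element determines its coset, so the preimage of a set of cosets is their
      union, which is open by definition of the quotient topology.\<close>
    have "{g \<in> carrier G. N #>\<^bsub>G\<^esub> g \<in> \<U>} = \<Union>\<U>"
    proof (intro Set.set_eqI iffI)
      fix g assume "g \<in> \<Union>\<U>"
      then obtain B where B: "B \<in> \<U>" "g \<in> B" by blast
      with U(1) obtain a where a: "a \<in> carrier G" "B = N #>\<^bsub>G\<^esub> a" by (auto simp: carrier_FactGroup)
      then have "N #>\<^bsub>G\<^esub> g = B" using B repr_independence subgroup_axioms by metis
      then show "g \<in> {g \<in> carrier G. N #>\<^bsub>G\<^esub> g \<in> \<U>}"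
        using B a r_coset_subset_G[OF subset] by auto
    qed (use rcos_self[OF _ subgroup_axioms] in auto)
    then show ?thesis using U by simp
  qed
  moreover have "(\<lambda>g. N #>\<^bsub>G\<^esub> g) \<in> hom G (quotient_topgroup G N)"
    using r_coset_hom_Mod by (simp add: hom_def)
  ultimately show ?thesis
    using topological_groupD(2)[OF G] by (auto simp: cont_hom_def continuous_map_def top carrier_FactGroup)
qed

section \<open>Homomorphisms into discrete groups\<close>

text \<open>For topological groups \<open>G\<close> and groups \<open>Q\<close> these are the
  homomorphisms with open kernel. The target is a plain group, so finite quotients can be built with
  the algebraic constructions alone.\<close>

definition discrete_hom :: "'a topgroup \<Rightarrow> 'b monoid \<Rightarrow> ('a \<Rightarrow> 'b) set" where
  "discrete_hom G Q = {h \<in> hom G Q. continuous_map (gtop G) (discrete_topology (carrier Q)) h}"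

lemma discrete_hom_compose:
  assumes "h \<in> discrete_hom G Q" "k \<in> hom Q R"
  shows "(\<lambda>g. k (h g)) \<in> discrete_hom G R"
proof -
  have "h \<in> hom G Q" "continuous_map (gtop G) (discrete_topology (carrier Q)) h"
    "continuous_map (discrete_topology (carrier Q)) (discrete_topology (carrier R)) k"
    using assms by (simp_all add: discrete_hom_def hom_def)
  then have "k \<circ> h \<in> hom G R" "continuous_map (gtop G) (discrete_topology (carrier R)) (k \<circ> h)"
    using assms(2) by (blast intro: hom_compose continuous_map_compose)+
  then show ?thesis by (simp add: discrete_hom_def comp_def)
qed

lemma cont_discrete_hom_compose:
  assumes "i \<in> cont_hom A G" "h \<in> discrete_hom G Q"
  shows "(\<lambda>g. h (i g)) \<in> discrete_hom A Q"
proof -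
  have "i \<in> hom A G" "h \<in> hom G Q" "continuous_map (gtop A) (gtop G) i"
    "continuous_map (gtop G) (discrete_topology (carrier Q)) h"
    using assms by (simp_all add: discrete_hom_def cont_hom_def)
  then have "h \<circ> i \<in> hom A Q" "continuous_map (gtop A) (discrete_topology (carrier Q)) (h \<circ> i)"
    by (blast intro: hom_compose continuous_map_compose)+
  then show ?thesis by (simp add: discrete_hom_def comp_def)
qed

lemma discrete_hom_restrict:
  assumes "h \<in> discrete_hom G Q" "h ` carrier G \<subseteq> H" "H \<subseteq> carrier Q" "topspace (gtop G) = carrier G"
  shows "h \<in> discrete_hom G (Q\<lparr>carrier := H\<rparr>)"
  using assms by (auto simp: discrete_hom_def hom_def continuous_map_def image_subset_iff)

text \<open>Every subset of a discrete space is closed, so closures add nothing to the image. Hence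
  topological generation and derived series map exactly onto their abstract counterparts.\<close>

lemma discrete_hom_closure_of:
  assumes "h \<in> discrete_hom G Q" "S \<subseteq> topspace (gtop G)"
  shows "h ` (gtop G closure_of S) = h ` S"
proof
  have "h ` S \<subseteq> carrier Q"
    using assms by (auto simp: discrete_hom_def continuous_map_def)
  moreover have "h ` (gtop G closure_of S) \<subseteq> discrete_topology (carrier Q) closure_of (h ` S)"
    using assms(1) by (simp add: discrete_hom_def continuous_map_image_closure_subset)
  ultimately show "h ` (gtop G closure_of S) \<subseteq> h ` S"
    by (simp add: discrete_topology_closure_of Int_absorb1)
qed (use closure_of_subset[OF assms(2)] in blast)

lemma discrete_hom_group_hom:
  "h \<in> discrete_hom G Q \<Longrightarrow> group G \<Longrightarrow> group Q \<Longrightarrow> group_hom G Q h"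
  by (simp add: discrete_hom_def group_hom_def group_hom_axioms_def)

lemma discrete_hom_closed_generate:
  assumes G: "topological_group G" and "group Q" and h: "h \<in> discrete_hom G Q" and S: "S \<subseteq> carrier G"
  shows "h ` closed_generate G S = generate Q (h ` S)"
proof -
  interpret group_hom G Q h using discrete_hom_group_hom h topological_groupD(1)[OF G] assms(2) by blast
  have "generate G S \<subseteq> topspace (gtop G)"
    using G.generate_in_carrier[OF S] topological_groupD(2)[OF G] by blast
  then show ?thesis
    unfolding closed_generate_def generate_img[OF S] by (rule discrete_hom_closure_of[OF h])
qed

lemma discrete_hom_top_derived:
  assumes G: "topological_group G" and "group Q" and h: "h \<in> discrete_hom G Q"
  shows "h ` top_derived G (Suc k) = derived Q (h ` top_derived G k)"
proof -
  interpret group_hom G Q h using discrete_hom_group_hom h topological_groupD(1)[OF G] assms(2) by blast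
  have "derived G (top_derived G k) \<subseteq> topspace (gtop G)"
    using G.derived_in_carrier top_derived_subset[OF G] topological_groupD(2)[OF G] by metis
  then show ?thesis
    unfolding top_derived.simps derived_img[OF top_derived_subset[OF G]]
    by (rule discrete_hom_closure_of[OF h])
qed

lemma (in group) derived_commuting:
  assumes "K \<subseteq> carrier G" "\<And>a b. a \<in> K \<Longrightarrow> b \<in> K \<Longrightarrow> a \<otimes> b = b \<otimes> a"
  shows "derived G K = {\<one>}"
proof -
  have "a \<otimes> b \<otimes> inv a \<otimes> inv b = \<one>" if "a \<in> K" "b \<in> K" for a b
  proof -
    have "a \<in> carrier G" "b \<in> carrier G" using that assms(1) by auto
    then show ?thesis using assms(2)[OF that] by (simp add: m_assoc)
  qed
  then have "derived_set G K \<subseteq> {\<one>}" by auto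
  then have "derived G K \<subseteq> {\<one>}"
    unfolding derived_def using mono_generate[of "derived_set G K" "{\<one>}"] generate_one by simp
  then show ?thesis
    using generate.one[of G] unfolding derived_def by blast
qed

section \<open>Finite groups as test objects of the free product\<close>

lemma finite_sigma_groupD:
  assumes "finite_sigma_group \<Sigma> Q"
  shows "group Q" "finite (carrier Q)" "prime p \<Longrightarrow> p dvd order Q \<Longrightarrow> p \<in> \<Sigma>"
  using assms by (auto simp: finite_sigma_group_def)

lemma finite_sigma_group_iso:
  assumes "finite_sigma_group \<Sigma> Q" and "group R" and "h \<in> iso Q R"
  shows "finite_sigma_group \<Sigma> R"
proof -
  have "bij_betw h (carrier Q) (carrier R)" using assms(3) by (simp add: iso_def)
  then have "finite (carrier R)" "order R = order Q"
    using finite_sigma_groupD(2)[OF assms(1)] bij_betw_finite bij_betw_same_card[of h]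
    by (auto simp: order_def)
  then show ?thesis using assms by (simp add: finite_sigma_group_def)
qed

lemma finite_sigma_subgroup:
  assumes Q: "finite_sigma_group \<Sigma> Q" and H: "subgroup H Q"
  shows "finite_sigma_group \<Sigma> (Q\<lparr>carrier := H\<rparr>)"
proof -
  interpret group Q by (rule finite_sigma_groupD(1)[OF Q])
  have "card H dvd order Q" using lagrange[OF H] by (metis dvd_triv_right)
  then show ?thesis
    using Q H subgroup_imp_group[OF H] finite_subset[OF subgroup.subset[OF H]]
    by (auto simp: finite_sigma_group_def order_def intro: dvd_trans)
qed

lemma finite_sigma_Mod:
  assumes Q: "finite_sigma_group \<Sigma> Q" and N: "N \<lhd> Q"
  shows "finite_sigma_group \<Sigma> (Q Mod N)"
proof -
  interpret normal N Q by fact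
  have "order (Q Mod N) dvd order Q"
    using lagrange[OF subgroup_axioms] by (metis dvd_triv_left order_def FactGroup_def partial_object.select_convs(1))
  moreover have "finite (carrier (Q Mod N))"
    using finite_sigma_groupD(2)[OF Q] by (simp add: carrier_FactGroup)
  ultimately show ?thesis
    using Q factorgroup_is_group by (auto simp: finite_sigma_group_def intro: dvd_trans)
qed

lemma finite_sigma_DirProd:
  assumes "finite_sigma_group \<Sigma> Q" "finite_sigma_group \<Sigma> R"
  shows "finite_sigma_group \<Sigma> (Q \<times>\<times> R)"
  using assms DirProd_group
  by (auto simp: finite_sigma_group_def order_def card_cartesian_product prime_dvd_mult_iff)

text \<open>The order is \<open>l ^ card (carrier Q)\<close> times the order of \<open>Q\<close>, so
  its only possible new prime is \<open>l\<close>.\<close>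

lemma finite_sigma_wreath:
  assumes Q: "finite_sigma_group \<Sigma> Q" and l: "prime l" "l \<in> \<Sigma>"
  shows "finite_sigma_group \<Sigma> (wreath l Q)"
proof -
  have fin: "finite (carrier Q)" by (rule finite_sigma_groupD(2)[OF Q])
  have "order (wreath l Q) = l ^ card (carrier Q) * order Q"
    using fin by (simp add: order_def carrier_wreath card_cartesian_product card_PiE)
  then have "p \<in> \<Sigma>" if "prime p" "p dvd order (wreath l Q)" for p
    using that l finite_sigma_groupD(3)[OF Q, of p] prime_dvd_power[of p l] primes_dvd_imp_eq[of p l]
    by (auto simp: prime_dvd_mult_iff)
  moreover have "finite (carrier (wreath l Q))"
    using fin by (auto simp: carrier_wreath intro!: finite_PiE)
  ultimately show ?thesis
    using group_wreath[OF finite_sigma_groupD(1)[OF Q]] prime_gt_0_nat[OF l(1)]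
    by (auto simp: finite_sigma_group_def)
qed

section \<open>Finite groups transported to a prescribed type\<close>

text \<open>The structure is transported along an injection into the infinite type. Copies are
  needed because the inverse systems use groups over \<open>nat\<close> and the coproduct property
  tests one fixed type.\<close>

lemma isomorphic_copy:
  fixes Q :: "'d monoid"
  assumes Q: "group Q" "finite (carrier Q)" and inf: "infinite (UNIV :: 'h set)"
  obtains H :: "'h monoid" and e where "group H" "e \<in> iso Q H"
proof -
  obtain B :: "'h set" where "finite B" "card B = card (carrier Q)"
    using infinite_arbitrarily_large[OF inf] by blast
  then obtain e :: "'d \<Rightarrow> 'h" where e: "inj_on e (carrier Q)"
    using card_le_inj[of "carrier Q" B] Q(2) by auto
  define H where "H = \<lparr>carrier = e ` carrier Q,
    monoid.mult = (\<lambda>a b. e (inv_into (carrier Q) e a \<otimes>\<^bsub>Q\<^esub> inv_into (carrier Q) e b)), one = e \<one>\<^bsub>Q\<^esub>\<rparr>"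
  have iso: "e \<in> iso Q H"
    using e group.is_monoid[OF Q(1)] by (auto simp: iso_def hom_def H_def bij_betw_def)
  \<comment> \<open>The record update changes nothing, since \<open>H\<close> already has this
    unit.\<close>
  have "group (H\<lparr>one := e \<one>\<^bsub>Q\<^esub>\<rparr>)" using group.iso_imp_img_group[OF Q(1) iso] .
  then have "group H" by (simp add: H_def)
  then show ?thesis using iso that by blast
qed

lemma topological_group_discrete:
  assumes "group H" "gtop H = discrete_topology (carrier H)"
  shows "topological_group H"
proof -
  interpret group H by fact
  show ?thesis
    using assms by (auto simp: topological_group_def prod_topology_discrete_topology[symmetric])
qed

lemma topspace_inverse_limit:
  "topspace (gtop (inverse_limit I R Q \<phi>)) = carrier (inverse_limit I R Q \<phi>)"
  and carrier_inverse_limit: "carrier (inverse_limit I R Q \<phi>) =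
    {a \<in> \<Pi>\<^sub>E i\<in>I. carrier (Q i). \<forall>i\<in>I. \<forall>j\<in>I. R i j \<longrightarrow> \<phi> i j (a j) = a i}"
  and mult_inverse_limit: "monoid.mult (inverse_limit I R Q \<phi>) = (\<lambda>x y. \<lambda>i\<in>I. x i \<otimes>\<^bsub>Q i\<^esub> y i)"
  and gtop_inverse_limit: "gtop (inverse_limit I R Q \<phi>) =
    subtopology (product_topology (\<lambda>i. discrete_topology (carrier (Q i))) I) (carrier (inverse_limit I R Q \<phi>))"
  by (auto simp: inverse_limit_def Let_def monoid.defs)

text \<open>A finite discrete group is the limit of a constant system with a single index.
  \<open>N\<close> is a copy of \<open>K\<close> over \<open>nat\<close>, the type that the
  definition of \<open>pro_sigma_group\<close> prescribes.\<close>

lemma pro_sigma_group_discrete: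
  fixes H :: "'a topgroup"
  assumes H: "group H" "gtop H = discrete_topology (carrier H)"
    and K: "finite_sigma_group \<Sigma> (K :: 'k monoid)" and e: "e \<in> iso K H"
  shows "pro_sigma_group \<Sigma> H"
proof -
  have finH: "finite (carrier H)"
    using e finite_sigma_groupD(2)[OF K] by (auto simp: iso_def dest: bij_betw_finite)
  obtain N :: "nat monoid" and d where N: "group N" "d \<in> iso K N"
    using isomorphic_copy[OF finite_sigma_groupD(1,2)[OF K], where 'h=nat] by auto
  have "inv_into (carrier K) e \<in> iso H K"
    using group.iso_set_sym[OF finite_sigma_groupD(1)[OF K] e] .
  then obtain c where c: "c \<in> iso H N" using iso_set_trans N(2) by blast
  have sN: "finite_sigma_group \<Sigma> N" using finite_sigma_group_iso K N by blast
  \<comment> \<open>Indices must be subsets of the type of \<open>H\<close>; any single one would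
    do.\<close>
  define I where "I = {{} :: 'a set}"
  define L where "L = inverse_limit I (\<lambda>_ _. True) (\<lambda>_. N) (\<lambda>_ _ a. a)"
  have sys: "inverse_system I (\<lambda>_ _. True) (\<lambda>_. N) (\<lambda>_ _ a. a)"
    using N(1) by (auto simp: inverse_system_def directed_preorder_def I_def hom_def)
  define h where "h = (\<lambda>a. \<lambda>i\<in>I. c a)"
  have carL: "carrier L = (\<Pi>\<^sub>E i\<in>I. carrier N)" by (auto simp: L_def carrier_inverse_limit I_def)
  have bij: "bij_betw h (carrier H) (carrier L)"
  proof (rule bij_betw_imageI)
    have cb: "bij_betw c (carrier H) (carrier N)" using c by (simp add: iso_def)
    show "inj_on h (carrier H)"
    proof (rule inj_onI)
      fix a b assume ab: "a \<in> carrier H" "b \<in> carrier H" "h a = h b"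
      then have "h a {} = h b {}" by simp
      then have "c a = c b" by (simp add: h_def I_def)
      then show "a = b" using ab cb by (auto simp: bij_betw_def dest: inj_onD)
    qed
    show "h ` carrier H = carrier L"
    proof
      show "h ` carrier H \<subseteq> carrier L" using cb by (auto simp: h_def carL bij_betw_def)
      show "carrier L \<subseteq> h ` carrier H"
      proof
        fix a assume a: "a \<in> carrier L"
        then have "a {} \<in> carrier N" by (auto simp: carL I_def)
        then obtain b where b: "b \<in> carrier H" "c b = a {}" by (metis cb bij_betw_imp_surj_on imageE)
        have "h b = a"
          using a b by (intro extensionalityI[of _ I]) (auto simp: h_def carL I_def PiE_iff)
        then show "a \<in> h ` carrier H" using b by blast
      qed
    qed
  qed
  \<comment> \<open>A finite Hausdorff space is discrete, so the bijection \<open>h\<close> is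
    automatically a homeomorphism.\<close>
  have "Hausdorff_space (gtop L)"
    by (simp add: L_def gtop_inverse_limit Hausdorff_space_subtopology Hausdorff_space_product_topology)
  moreover have "finite (carrier L)" using bij finH bij_betw_finite by blast
  ultimately have disc: "gtop L = discrete_topology (carrier L)"
    using topspace_inverse_limit unfolding L_def
    by (blast intro: finite_t1_space_imp_discrete_topology Hausdorff_imp_t1_space)
  have hom: "h \<in> hom H L"
  proof (rule homI)
    fix a b assume "a \<in> carrier H" "b \<in> carrier H"
    then have "c (a \<otimes>\<^bsub>H\<^esub> b) = c a \<otimes>\<^bsub>N\<^esub> c b" using c by (simp add: iso_def hom_def)
    then show "h (a \<otimes>\<^bsub>H\<^esub> b) = h a \<otimes>\<^bsub>L\<^esub> h b"
      unfolding L_def mult_inverse_limit h_def by (simp cong: restrict_cong)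
  qed (use bij in \<open>auto simp: bij_betw_def\<close>)
  have hm: "homeomorphic_map (gtop H) (gtop L) h"
    unfolding homeomorphic_eq_everything_map H(2) disc
    using bij by (auto simp: bij_betw_def open_map_def closed_map_def)
  have "h \<in> top_iso H L" using hom hm bij by (simp add: top_iso_def iso_def)
  then show ?thesis
    using topological_group_discrete[OF H] sys sN unfolding pro_sigma_group_def L_def by blast
qed

lemma discrete_copy:
  assumes Q: "finite_sigma_group \<Sigma> Q" and "infinite (UNIV :: 'h set)"
  obtains H :: "'h topgroup" and e where "pro_sigma_group \<Sigma> H" "e \<in> iso Q H" "group H"
    "gtop H = discrete_topology (carrier H)"
proof -
  obtain H0 :: "'h monoid" and e where H0: "group H0" "e \<in> iso Q H0"
    using isomorphic_copy[OF finite_sigma_groupD(1,2)[OF Q] assms(2)] by blast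
  define H :: "'h topgroup" where "H = monoid.extend H0 \<lparr>gtop = discrete_topology (carrier H0)\<rparr>"
  have H: "carrier H = carrier H0" "monoid.mult H = monoid.mult H0" "\<one>\<^bsub>H\<^esub> = \<one>\<^bsub>H0\<^esub>"
    "gtop H = discrete_topology (carrier H)"
    by (simp_all add: H_def monoid.defs)
  interpret H0: group H0 by fact
  have gH: "group H"
    by (rule groupI) (use H0.m_assoc H0.l_inv_ex in \<open>auto simp: H(1,2,3)\<close>)
  have eH: "e \<in> iso Q H" using H0(2) by (simp add: iso_def hom_def H(1,2,3))
  show ?thesis
    using that pro_sigma_group_discrete[OF gH H(4) Q eH] eH gH H(4) by blast
qed

lemma discrete_hom_iso_cont_hom:
  assumes k: "k \<in> discrete_hom G Q" and e: "e \<in> iso Q H" and H: "gtop H = discrete_topology (carrier H)"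
  shows "(\<lambda>a. e (k a)) \<in> cont_hom G H"
proof -
  have "k \<in> hom G Q" "continuous_map (gtop G) (discrete_topology (carrier Q)) k"
    "e \<in> hom Q H" "continuous_map (discrete_topology (carrier Q)) (gtop H) e"
    using k e by (simp_all add: discrete_hom_def iso_def hom_def H)
  then have "e \<circ> k \<in> hom G H" "continuous_map (gtop G) (gtop H) (e \<circ> k)"
    by (blast intro: hom_compose continuous_map_compose)+
  then show ?thesis by (simp add: cont_hom_def comp_def)
qed

section \<open>The coproduct property tested on finite groups\<close>

text \<open>\<open>Q\<close> may live over any type: it is replaced by a discrete copy
  \<open>H\<close> over the test type, and the map obtained there is brought back by the inverse
  isomorphism.\<close>

lemma free_pro_sigma_product_lift:
  fixes Q :: "'d monoid" and F :: "'c topgroup" and A :: "'a topgroup" and B :: "'b topgroup"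
  assumes F: "free_pro_sigma_product \<Sigma> A B F \<iota>\<^sub>A \<iota>\<^sub>B" and Q: "finite_sigma_group \<Sigma> Q"
    and f: "f \<in> discrete_hom A Q" and g: "g \<in> discrete_hom B Q"
  obtains h where "h \<in> discrete_hom F Q" "\<And>a. a \<in> carrier A \<Longrightarrow> h (\<iota>\<^sub>A a) = f a"
    "\<And>b. b \<in> carrier B \<Longrightarrow> h (\<iota>\<^sub>B b) = g b"
proof -
  have "infinite (UNIV :: ('a + 'b + 'c + nat) set set set)"
    by (simp add: Finite_Set.finite_set)
  then obtain H :: "('a + 'b + 'c + nat) set set topgroup" and e
    where H: "pro_sigma_group \<Sigma> H" "group H" "gtop H = discrete_topology (carrier H)" and e: "e \<in> iso Q H"
    using discrete_copy[OF Q] by blast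
  note push = discrete_hom_iso_cont_hom[OF _ e H(3)]
  obtain h where h: "h \<in> cont_hom F H" "\<forall>a\<in>carrier A. h (\<iota>\<^sub>A a) = e (f a)" "\<forall>b\<in>carrier B. h (\<iota>\<^sub>B b) = e (g b)"
    using F H(1) push[OF f] push[OF g] unfolding free_pro_sigma_product_def by (metis (no_types, lifting))
  let ?d = "inv_into (carrier Q) e"
  have inj: "inj_on e (carrier Q)" using e by (simp add: iso_def bij_betw_def)
  have "?d \<in> iso H Q"
    using group.iso_set_sym[OF finite_sigma_groupD(1)[OF Q] e] .
  then have d: "?d \<in> hom H Q" by (simp add: iso_def)
  then have "continuous_map (gtop H) (discrete_topology (carrier Q)) ?d" by (simp add: H(3) hom_def)
  then have "?d \<circ> h \<in> hom F Q" "continuous_map (gtop F) (discrete_topology (carrier Q)) (?d \<circ> h)"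
    using h(1) d unfolding cont_hom_def by (blast intro: hom_compose continuous_map_compose)+
  then have "(\<lambda>x. ?d (h x)) \<in> discrete_hom F Q" by (simp add: discrete_hom_def comp_def)
  moreover have "?d (h (\<iota>\<^sub>A a)) = f a" if "a \<in> carrier A" for a
  proof -
    have "f a \<in> carrier Q" using f that by (auto simp: discrete_hom_def hom_def)
    then show ?thesis using h(2) that inj by simp
  qed
  moreover have "?d (h (\<iota>\<^sub>B b)) = g b" if "b \<in> carrier B" for b
  proof -
    have "g b \<in> carrier Q" using g that by (auto simp: discrete_hom_def hom_def)
    then show ?thesis using h(3) that inj by simp
  qed
  ultimately show ?thesis using that by blast
qed

text \<open>After composition with \<open>e\<close> and restriction to \<open>carrier F\<close>,
  both maps solve the same lifting problem into \<open>H\<close>. The restriction is there because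
  uniqueness concerns extensional functions.\<close>

lemma free_pro_sigma_product_unique:
  fixes Q :: "'d monoid" and F :: "'c topgroup" and A :: "'a topgroup" and B :: "'b topgroup"
  assumes F: "free_pro_sigma_product \<Sigma> A B F \<iota>\<^sub>A \<iota>\<^sub>B" and Q: "finite_sigma_group \<Sigma> Q"
    and h: "h \<in> discrete_hom F Q" and h': "h' \<in> discrete_hom F Q"
    and A: "\<And>a. a \<in> carrier A \<Longrightarrow> h (\<iota>\<^sub>A a) = h' (\<iota>\<^sub>A a)" and B: "\<And>b. b \<in> carrier B \<Longrightarrow> h (\<iota>\<^sub>B b) = h' (\<iota>\<^sub>B b)"
    and x: "x \<in> carrier F"
  shows "h x = h' x"
proof -
  have tgF: "topological_group F" and i: "\<iota>\<^sub>A \<in> cont_hom A F" "\<iota>\<^sub>B \<in> cont_hom B F"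
    using F by (simp_all add: free_pro_sigma_product_def pro_sigma_group_def)
  interpret F: group F by (rule topological_groupD(1)[OF tgF])
  have "infinite (UNIV :: ('a + 'b + 'c + nat) set set set)"
    by (simp add: Finite_Set.finite_set)
  then obtain H :: "('a + 'b + 'c + nat) set set topgroup" and e
    where H: "pro_sigma_group \<Sigma> H" "group H" "gtop H = discrete_topology (carrier H)" and e: "e \<in> iso Q H"
    using discrete_copy[OF Q] by blast
  note push = discrete_hom_iso_cont_hom[OF _ e H(3)]
  have inj: "inj_on e (carrier Q)" using e by (simp add: iso_def bij_betw_def)
  let ?P = "\<lambda>k. k \<in> cont_hom F H \<and> k \<in> extensional (carrier F) \<and>
      (\<forall>a\<in>carrier A. k (\<iota>\<^sub>A a) = e (h (\<iota>\<^sub>A a))) \<and> (\<forall>b\<in>carrier B. k (\<iota>\<^sub>B b) = e (h (\<iota>\<^sub>B b)))"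
  have ex1: "\<exists>!k. ?P k"
    using F H(1) push[OF cont_discrete_hom_compose[OF i(1) h]] push[OF cont_discrete_hom_compose[OF i(2) h]]
    unfolding free_pro_sigma_product_def by blast
  have P: "?P (\<lambda>x\<in>carrier F. e (k x))"
    if k: "k \<in> discrete_hom F Q" and "\<And>a. a \<in> carrier A \<Longrightarrow> k (\<iota>\<^sub>A a) = h (\<iota>\<^sub>A a)"
      "\<And>b. b \<in> carrier B \<Longrightarrow> k (\<iota>\<^sub>B b) = h (\<iota>\<^sub>B b)" for k
  proof -
    have c: "(\<lambda>x. e (k x)) \<in> hom F H" "continuous_map (gtop F) (gtop H) (\<lambda>x. e (k x))"
      using push[OF k] by (simp_all add: cont_hom_def)
    then have "continuous_map (gtop F) (gtop H) (\<lambda>x\<in>carrier F. e (k x))"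
      by (rule_tac continuous_map_eq) (simp_all add: topological_groupD(2)[OF tgF])
    moreover have "(\<lambda>x\<in>carrier F. e (k x)) \<in> hom F H"
      using c(1) by (auto simp: hom_def)
    moreover have "\<iota>\<^sub>A a \<in> carrier F" if "a \<in> carrier A" for a
      using i(1) that by (auto simp: cont_hom_def hom_def)
    moreover have "\<iota>\<^sub>B b \<in> carrier F" if "b \<in> carrier B" for b
      using i(2) that by (auto simp: cont_hom_def hom_def)
    ultimately show ?thesis using that(2,3) by (simp add: cont_hom_def)
  qed
  obtain k where k: "\<And>k'. ?P k' \<Longrightarrow> k' = k" using ex1 by (elim ex1E) blast
  have "(\<lambda>x\<in>carrier F. e (h x)) = k" by (rule k[OF P[OF h]]) simp_all
  moreover have "(\<lambda>x\<in>carrier F. e (h' x)) = k" by (rule k[OF P[OF h']]) (simp_all add: A B)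
  ultimately have "(\<lambda>x\<in>carrier F. e (h x)) = (\<lambda>x\<in>carrier F. e (h' x))" by simp
  then have "e (h x) = e (h' x)" using x by (metis restrict_apply')
  moreover have "h x \<in> carrier Q" "h' x \<in> carrier Q"
    using h h' x by (auto simp: discrete_hom_def hom_def)
  ultimately show "h x = h' x" using inj by (auto dest: inj_onD)
qed

section \<open>Profinite topology\<close>

text \<open>Each compatibility condition is the equalizer of two continuous maps into a Hausdorff
  space, hence closed.\<close>

lemma closedin_inverse_limit:
  assumes sys: "inverse_system I R Q \<phi>"
  shows "closedin (product_topology (\<lambda>i. discrete_topology (carrier (Q i))) I) (carrier (inverse_limit I R Q \<phi>))"
proof -
  let ?X = "product_topology (\<lambda>i. discrete_topology (carrier (Q i))) I"
  let ?E = "\<lambda>(i, j). {a \<in> topspace ?X. \<phi> i j (a j) = a i}"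
  have "closedin ?X (?E (i, j))" if "i \<in> I" "j \<in> I" "R i j" for i j
  proof -
    have "\<phi> i j \<in> hom (Q j) (Q i)" using sys that by (simp add: inverse_system_def)
    then have "continuous_map (discrete_topology (carrier (Q j))) (discrete_topology (carrier (Q i))) (\<phi> i j)"
      by (simp add: hom_def)
    from continuous_map_compose[OF continuous_map_product_projection[OF \<open>j \<in> I\<close>, of "\<lambda>i. discrete_topology (carrier (Q i))"] this]
    have "continuous_map ?X (discrete_topology (carrier (Q i))) (\<lambda>a. \<phi> i j (a j))"
      by (simp add: comp_def)
    from closedin_continuous_maps_eq[OF Hausdorff_space_discrete_topology this
        continuous_map_product_projection[OF \<open>i \<in> I\<close>, of "\<lambda>i. discrete_topology (carrier (Q i))"]]
    show ?thesis by simp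
  qed
  \<comment> \<open>Inserting the whole space guarantees the nonempty family that
    \<open>closedin_Inter\<close> requires.\<close>
  then have closed: "closedin ?X K"
    if "K \<in> insert (topspace ?X) (?E ` {(i, j). i \<in> I \<and> j \<in> I \<and> R i j})" for K
    using that closedin_topspace[of ?X] by blast
  have "carrier (inverse_limit I R Q \<phi>)
      = \<Inter>(insert (topspace ?X) (?E ` {(i, j). i \<in> I \<and> j \<in> I \<and> R i j}))"
    unfolding carrier_inverse_limit by fastforce
  then show ?thesis
    using closed by (simp only:) (rule closedin_Inter, auto)
qed

lemma pro_sigma_groupE:
  fixes G :: "'a topgroup"
  assumes "pro_sigma_group \<Sigma> G"
  obtains I :: "'a set set" and R Q \<phi> e where "inverse_system I R Q \<phi>" "\<And>i. i \<in> I \<Longrightarrow> finite_sigma_group \<Sigma> (Q i :: nat monoid)"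
    "e \<in> iso G (inverse_limit I R Q \<phi>)" "homeomorphic_map (gtop G) (gtop (inverse_limit I R Q \<phi>)) e"
proof -
  obtain I :: "'a set set" and R and Q :: "'a set \<Rightarrow> nat monoid" and \<phi> where *: "inverse_system I R Q \<phi>"
    "\<forall>i\<in>I. finite_sigma_group \<Sigma> (Q i)" "top_iso G (inverse_limit I R Q \<phi>) \<noteq> {}"
    using assms unfolding pro_sigma_group_def by blast
  then obtain e where "e \<in> top_iso G (inverse_limit I R Q \<phi>)" by blast
  then show ?thesis using that[of I R Q \<phi> e] * by (simp add: top_iso_def)
qed

text \<open>By Tychonoff the product of the finite discrete groups is compact, and the limit is
  closed in it.\<close>

lemma pro_sigma_group_compact_Hausdorff:
  fixes G :: "'a topgroup"
  assumes "pro_sigma_group \<Sigma> G"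
  shows "compact_space (gtop G)" "Hausdorff_space (gtop G)"
proof -
  obtain I :: "'a set set" and R Q \<phi> e where sys: "inverse_system I R Q \<phi>"
    and fin: "\<And>i. i \<in> I \<Longrightarrow> finite_sigma_group \<Sigma> (Q i :: nat monoid)"
    and hm: "homeomorphic_map (gtop G) (gtop (inverse_limit I R Q \<phi>)) e"
    using pro_sigma_groupE[OF assms] by metis
  let ?X = "product_topology (\<lambda>i. discrete_topology (carrier (Q i))) I"
  have "compact_space ?X"
    using finite_sigma_groupD(2)[OF fin] by (simp add: compact_space_product_topology compact_space_discrete_topology)
  then have "compact_space (gtop (inverse_limit I R Q \<phi>))"
    unfolding gtop_inverse_limit
    using closedin_inverse_limit[OF sys] closedin_compact_space compact_space_subtopology by blast
  moreover have "Hausdorff_space (gtop (inverse_limit I R Q \<phi>))"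
    by (simp add: gtop_inverse_limit Hausdorff_space_subtopology Hausdorff_space_product_topology)
  ultimately show "compact_space (gtop G)" "Hausdorff_space (gtop G)"
    using homeomorphic_compact_space homeomorphic_Hausdorff_space homeomorphic_map_imp_homeomorphic_space[OF hm]
    by blast+
qed

section \<open>Separation by finite quotients\<close>

lemma directed_finite_bound:
  assumes dir: "directed_preorder I R" and "finite F" "F \<subseteq> I"
  shows "\<exists>k\<in>I. \<forall>i\<in>F. R i k"
  using assms(2,3)
proof (induction F)
  case empty
  have "I \<noteq> {}" using dir unfolding directed_preorder_def by blast
  then show ?case by blast
next
  case (insert i F)
  then obtain j where j: "j \<in> I" "\<forall>i\<in>F. R i j" by blast
  have ub: "\<forall>a\<in>I. \<forall>b\<in>I. \<exists>k\<in>I. R a k \<and> R b k"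
    and trans: "\<forall>a\<in>I. \<forall>b\<in>I. \<forall>c\<in>I. R a b \<longrightarrow> R b c \<longrightarrow> R a c"
    using dir unfolding directed_preorder_def by blast+
  obtain k where k: "k \<in> I" "R i k" "R j k" using ub j(1) insert.prems by blast
  have "R a k" if "a \<in> F" for a
    using trans j k that insert.prems by blast
  then show ?case using k by blast
qed

text \<open>A basic open set of the product restricts finitely many coordinates. A single index
  above all of them determines these coordinates, so the projection to it serves as
  \<open>h\<close>.\<close>

lemma pro_sigma_group_separation:
  fixes G :: "'a topgroup"
  assumes G: "pro_sigma_group \<Sigma> G" and U: "openin (gtop G) U" "g \<in> U"
  obtains Q :: "nat monoid" and h where "finite_sigma_group \<Sigma> Q" "h \<in> discrete_hom G Q"
    "\<And>y. \<lbrakk>y \<in> carrier G; h y = h g\<rbrakk> \<Longrightarrow> y \<in> U"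
proof -
  obtain I :: "'a set set" and R Q \<phi> e where sys: "inverse_system I R Q \<phi>"
    and fin: "\<And>i. i \<in> I \<Longrightarrow> finite_sigma_group \<Sigma> (Q i :: nat monoid)"
    and iso: "e \<in> iso G (inverse_limit I R Q \<phi>)"
    and hm: "homeomorphic_map (gtop G) (gtop (inverse_limit I R Q \<phi>)) e"
    using pro_sigma_groupE[OF G] by metis
  let ?L = "inverse_limit I R Q \<phi>" and ?X = "product_topology (\<lambda>i. discrete_topology (carrier (Q i))) I"
  have top: "topspace (gtop G) = carrier G"
    using G topological_groupD(2) by (auto simp: pro_sigma_group_def)
  have g: "g \<in> carrier G" using U openin_subset top by blast
  have eL: "e y \<in> carrier ?L" if "y \<in> carrier G" for y using iso that by (auto simp: iso_def hom_def)
  have inj: "inj_on e (carrier G)" using iso by (simp add: iso_def bij_betw_def)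
  have "openin (gtop ?L) (e ` U)"
    using hm U(1) by (auto simp: homeomorphic_eq_everything_map open_map_def)
  then obtain W where W: "openin ?X W" "e ` U = W \<inter> carrier ?L"
    by (auto simp: gtop_inverse_limit openin_subtopology)
  then have "e g \<in> W" using U(2) by blast
  then obtain V where V: "finite {i \<in> I. V i \<noteq> carrier (Q i)}" "e g \<in> Pi\<^sub>E I V" "Pi\<^sub>E I V \<subseteq> W"
    using W(1) unfolding openin_product_topology_alt by auto
  obtain k where k: "k \<in> I" "\<And>i. \<lbrakk>i \<in> I; V i \<noteq> carrier (Q i)\<rbrakk> \<Longrightarrow> R i k"
    using directed_finite_bound[of I R "{i \<in> I. V i \<noteq> carrier (Q i)}"] sys V(1)
    unfolding inverse_system_def by auto
  let ?h = "\<lambda>y. e y k"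
  have "y \<in> U" if y: "y \<in> carrier G" "?h y = ?h g" for y
  proof -
    have "e y \<in> Pi\<^sub>E I V"
    proof (rule PiE_I)
      fix i assume i: "i \<in> I"
      show "e y i \<in> V i"
      proof (cases "V i = carrier (Q i)")
        case True
        then show ?thesis using eL[OF y(1)] i by (auto simp: carrier_inverse_limit)
      next
        case False
        then have "R i k" using k i by blast
        then have "e y i = \<phi> i k (e y k)" "e g i = \<phi> i k (e g k)"
          using eL[OF y(1)] eL[OF g] i k(1) by (auto simp: carrier_inverse_limit)
        then have "e y i = e g i" using y(2) by simp
        then show ?thesis using V(2) i by auto
      qed
    qed (use eL[OF y(1)] in \<open>auto simp: carrier_inverse_limit\<close>)
    then have "e y \<in> e ` U" using W(2) V(3) eL[OF y(1)] by blast
    moreover have "U \<subseteq> carrier G" using U(1) openin_subset top by blast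
    ultimately show ?thesis using inj y(1) by (auto simp: inj_on_def)
  qed
  moreover have "?h \<in> discrete_hom G (Q k)"
  proof -
    have "continuous_map (gtop ?L) (discrete_topology (carrier (Q k))) (\<lambda>a. a k)"
      unfolding gtop_inverse_limit
      by (intro continuous_map_from_subtopology continuous_map_product_projection[OF k(1)])
    from continuous_map_compose[OF homeomorphic_imp_continuous_map[OF hm] this]
    have "continuous_map (gtop G) (discrete_topology (carrier (Q k))) ?h" by (simp add: comp_def)
    moreover have "?h \<in> hom G (Q k)"
    proof (rule homI)
      fix a b assume ab: "a \<in> carrier G" "b \<in> carrier G"
      then have "e (a \<otimes>\<^bsub>G\<^esub> b) = e a \<otimes>\<^bsub>?L\<^esub> e b" using iso by (simp add: iso_def hom_def)
      then show "?h (a \<otimes>\<^bsub>G\<^esub> b) = ?h a \<otimes>\<^bsub>Q k\<^esub> ?h b" using k(1) by (simp add: mult_inverse_limit)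
    qed (use eL k(1) in \<open>auto simp: carrier_inverse_limit\<close>)
    ultimately show ?thesis by (simp add: discrete_hom_def)
  qed
  ultimately show ?thesis using that fin[OF k(1)] by blast
qed

lemma pro_sigma_group_separation_neq:
  assumes G: "pro_sigma_group \<Sigma> G" and ab: "a \<in> carrier G" "b \<in> carrier G" "a \<noteq> b"
  obtains Q :: "nat monoid" and h where "finite_sigma_group \<Sigma> Q" "h \<in> discrete_hom G Q" "h a \<noteq> h b"
proof -
  have top: "topspace (gtop G) = carrier G"
    using G topological_groupD(2) by (auto simp: pro_sigma_group_def)
  have "closedin (gtop G) {b}"
    using pro_sigma_group_compact_Hausdorff(2)[OF G] ab top by (simp add: closedin_Hausdorff_singleton)
  then have "openin (gtop G) (carrier G - {b})" using top by (metis closedin_def)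
  then show ?thesis
    using pro_sigma_group_separation[OF G, of "carrier G - {b}" a] ab that by (metis DiffE DiffI singletonD singletonI)
qed

text \<open>The product set is the image of a compact set under multiplication, and compact sets in
  a Hausdorff space are closed.\<close>

lemma closedin_set_mult:
  assumes G: "pro_sigma_group \<Sigma> G" and "closedin (gtop G) S" "closedin (gtop G) T"
  shows "closedin (gtop G) (S <#>\<^bsub>G\<^esub> T)"
proof -
  note ch = pro_sigma_group_compact_Hausdorff[OF G]
  have "continuous_map (prod_topology (gtop G) (gtop G)) (gtop G) (\<lambda>(a, b). a \<otimes>\<^bsub>G\<^esub> b)"
    using G by (simp add: pro_sigma_group_def topological_group_def)
  moreover have "compactin (prod_topology (gtop G) (gtop G)) (S \<times> T)"
    using assms(2,3) ch by (simp add: compactin_Times closedin_compact_space)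
  ultimately have "compactin (gtop G) ((\<lambda>(a, b). a \<otimes>\<^bsub>G\<^esub> b) ` (S \<times> T))" by (rule_tac image_compactin)
  moreover have "(\<lambda>(a, b). a \<otimes>\<^bsub>G\<^esub> b) ` (S \<times> T) = S <#>\<^bsub>G\<^esub> T" by (auto simp: set_mult_def)
  ultimately show ?thesis using compactin_imp_closedin[OF ch(2)] by simp
qed

section \<open>The centralizer of a power of the generator\<close>

lemma finite_quotient_centralizer:
  assumes F: "free_pro_sigma_product \<Sigma> C P \<Omega> \<iota>\<^sub>C \<iota>\<^sub>P"
    and x: "x \<in> carrier C" "closed_generate C {x} = carrier C"
    and Q: "finite_sigma_group \<Sigma> Q" and \<psi>: "\<psi> \<in> discrete_hom \<Omega> Q"
    and kill: "\<psi> ` top_derived \<Omega> k \<subseteq> {\<one>\<^bsub>Q\<^esub>}"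
    and c: "c \<in> carrier C" and nontriv: "\<psi> (\<iota>\<^sub>C c) \<noteq> \<one>\<^bsub>Q\<^esub>" and \<gamma>: "\<gamma> \<in> carrier \<Omega>"
    and comm: "top_derived \<Omega> (Suc k) #>\<^bsub>\<Omega>\<^esub> (\<gamma> \<otimes>\<^bsub>\<Omega>\<^esub> \<iota>\<^sub>C c) = top_derived \<Omega> (Suc k) #>\<^bsub>\<Omega>\<^esub> (\<iota>\<^sub>C c \<otimes>\<^bsub>\<Omega>\<^esub> \<gamma>)"
  shows "\<psi> \<gamma> \<in> generate Q {\<psi> (\<iota>\<^sub>C x)}"
proof -
  have tg: "topological_group \<Omega>" "topological_group C" "topological_group P"
    and i: "\<iota>\<^sub>C \<in> cont_hom C \<Omega>" "\<iota>\<^sub>P \<in> cont_hom P \<Omega>"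
    using F by (simp_all add: free_pro_sigma_product_def pro_sigma_group_def)
  have ic: "\<iota>\<^sub>C c \<in> carrier \<Omega>" using i(1) c by (auto simp: cont_hom_def hom_def)
  interpret Q: group Q by (rule finite_sigma_groupD(1)[OF Q])
  interpret O: group \<Omega> by (rule topological_groupD(1)[OF tg(1)])
  have finQ: "finite (carrier Q)" by (rule finite_sigma_groupD(2)[OF Q])
  have \<psi>c: "\<psi> z \<in> carrier Q" if "z \<in> carrier \<Omega>" for z
    using \<psi> that by (auto simp: discrete_hom_def hom_def)
  define A where "A = generate Q {\<psi> (\<iota>\<^sub>C x)}"
  have \<psi>C: "(\<lambda>z. \<psi> (\<iota>\<^sub>C z)) \<in> discrete_hom C Q" by (rule cont_discrete_hom_compose[OF i(1) \<psi>])
  \<comment> \<open>As \<open>x\<close> generates \<open>C\<close> topologically, the image of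
    \<open>C\<close> in the discrete group \<open>Q\<close> is the abstract subgroup generated by
    the image of \<open>x\<close>.\<close>
  have imA: "(\<lambda>z. \<psi> (\<iota>\<^sub>C z)) ` carrier C = A"
    using discrete_hom_closed_generate[OF tg(2) Q.is_group \<psi>C, of "{x}"] x by (simp add: A_def)
  have "\<psi> (\<iota>\<^sub>C x) \<in> carrier Q" using \<psi>C x(1) by (auto simp: discrete_hom_def hom_def)
  then have A: "subgroup A Q" unfolding A_def by (intro Q.generate_is_subgroup) auto
  interpret A: subgroup A Q by (rule A)
  let ?a = "\<psi> (\<iota>\<^sub>C c)"
  have a: "?a \<in> A" using imA c by blast
  have gen: "subgroup (generate Q {?a}) Q" using A.mem_carrier[OF a] by (intro Q.generate_is_subgroup) auto
  have "card (generate Q {?a}) \<noteq> 1"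
  proof
    assume "card (generate Q {?a}) = 1"
    then obtain z where "generate Q {?a} = {z}" by (auto simp: card_1_singleton_iff)
    then show False using nontriv generate.one[of Q "{?a}"] generate.incl[of ?a "{?a}" Q] by auto
  qed
  then obtain l where l: "prime l" "l dvd card (generate Q {?a})" using prime_factor_nat by blast
  have l0: "l > 0" using l(1) by (rule prime_gt_0_nat)
  \<comment> \<open>This puts \<open>l\<close> in \<open>\<Sigma>\<close>, so that the wreath
    product is still an admissible test group.\<close>
  have "l dvd order Q" using l(2) Q.lagrange[OF gen] by (metis dvd_mult)
  then have l\<Sigma>: "l \<in> \<Sigma>" using finite_sigma_groupD(3)[OF Q l(1)] by blast
  \<comment> \<open>With the lifts as target instead of the whole wreath product, every value of
    \<open>h\<close> satisfies the coset congruences by construction.\<close>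
  define E where "E = (wreath l Q)\<lparr>carrier := derivation_lifts l Q A\<rparr>"
  have subE: "subgroup (derivation_lifts l Q A) (wreath l Q)"
    using subgroup_derivation_lifts[OF Q.is_group l0] A.subset by blast
  have E: "finite_sigma_group \<Sigma> E"
    unfolding E_def using finite_sigma_subgroup[OF finite_sigma_wreath[OF Q l(1) l\<Sigma>] subE] .
  interpret E: group E by (rule finite_sigma_groupD(1)[OF E])
  have carE: "carrier E = derivation_lifts l Q A" and multE: "monoid.mult E = monoid.mult (wreath l Q)"
    by (simp_all add: E_def)
  let ?z = "\<lambda>y\<in>carrier Q. 0 :: int"
  \<comment> \<open>The values on the two factors: \<open>D = 0\<close> on \<open>C\<close>, and
    \<open>D = 1 - \<psi>\<close> on \<open>P\<close>. The coproduct property joins them to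
    \<open>h = (D, \<psi>)\<close>.\<close>
  have "(\<lambda>q. (?z, q)) \<in> hom (Q\<lparr>carrier := A\<rparr>) E"
  proof (rule homI)
    fix q r assume "q \<in> carrier (Q\<lparr>carrier := A\<rparr>)" "r \<in> carrier (Q\<lparr>carrier := A\<rparr>)"
    then show "(?z, q \<otimes>\<^bsub>Q\<lparr>carrier := A\<rparr>\<^esub> r) = (?z, q) \<otimes>\<^bsub>E\<^esub> (?z, r)"
      by (auto simp: multE mult_wreath intro!: restrict_ext)
  qed (use zero_in_derivation_lifts[OF Q.is_group l0 A] carE in auto)
  moreover have "(\<lambda>z. \<psi> (\<iota>\<^sub>C z)) \<in> discrete_hom C (Q\<lparr>carrier := A\<rparr>)"
    using \<psi>C imA A.subset topological_groupD(2)[OF tg(2)] by (intro discrete_hom_restrict) auto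
  ultimately have f: "(\<lambda>z. (?z, \<psi> (\<iota>\<^sub>C z))) \<in> discrete_hom C E" by (rule_tac discrete_hom_compose)
  have "(\<lambda>q. (point_mass l Q q, q)) \<in> hom Q E"
    by (rule homI) (use point_mass_in_derivation_lifts[OF Q.is_group finQ l0 A.subset]
      point_mass_mult[OF Q.is_group] carE multE in auto)
  with cont_discrete_hom_compose[OF i(2) \<psi>]
  have g: "(\<lambda>z. (point_mass l Q (\<psi> (\<iota>\<^sub>P z)), \<psi> (\<iota>\<^sub>P z))) \<in> discrete_hom P E" by (rule discrete_hom_compose)
  obtain h where h: "h \<in> discrete_hom \<Omega> E" and hC: "\<And>z. z \<in> carrier C \<Longrightarrow> h (\<iota>\<^sub>C z) = (?z, \<psi> (\<iota>\<^sub>C z))"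
    and hP: "\<And>z. z \<in> carrier P \<Longrightarrow> h (\<iota>\<^sub>P z) = (point_mass l Q (\<psi> (\<iota>\<^sub>P z)), \<psi> (\<iota>\<^sub>P z))"
    using free_pro_sigma_product_lift[OF F E f g] by blast
  interpret h: group_hom \<Omega> E h
    by (rule discrete_hom_group_hom[OF h O.is_group E.is_group])
  have "snd \<in> hom E Q"
    by (rule homI) (auto simp: carE multE derivation_lifts_def carrier_wreath mult_wreath)
  with h have "(\<lambda>z. snd (h z)) \<in> discrete_hom \<Omega> Q" by (rule discrete_hom_compose)
  \<comment> \<open>Both sides agree on the images of \<open>C\<close> and \<open>P\<close>, hence
    everywhere by uniqueness.\<close>
  then have snd: "snd (h z) = \<psi> z" if "z \<in> carrier \<Omega>" for z
    by (rule free_pro_sigma_product_unique[OF F Q _ \<psi>]) (use hC hP that in auto)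
  have hc: "h z \<in> derivation_lifts l Q A" if "z \<in> carrier \<Omega>" for z
    using h.hom_closed[OF that] by (simp add: carE)
  \<comment> \<open>Elements killed by \<open>\<psi>\<close> land in the abelian group
    \<open>Z/l[Q]\<close>, so one further derived step is killed by \<open>h\<close>.\<close>
  have "derived E (h ` top_derived \<Omega> k) = {\<one>\<^bsub>E\<^esub>}"
  proof (rule E.derived_commuting)
    have sub: "top_derived \<Omega> k \<subseteq> carrier \<Omega>" by (rule top_derived_subset[OF tg(1)])
    then show "h ` top_derived \<Omega> k \<subseteq> carrier E" by auto
    fix u v assume "u \<in> h ` top_derived \<Omega> k" "v \<in> h ` top_derived \<Omega> k"
    then obtain s t where st: "s \<in> top_derived \<Omega> k" "t \<in> top_derived \<Omega> k" "u = h s" "v = h t" by blast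
    then have "snd u = \<one>\<^bsub>Q\<^esub>" "snd v = \<one>\<^bsub>Q\<^esub>" using snd kill sub by auto
    then obtain f g where "u = (f, \<one>\<^bsub>Q\<^esub>)" "v = (g, \<one>\<^bsub>Q\<^esub>)" by (metis prod.collapse)
    then show "u \<otimes>\<^bsub>E\<^esub> v = v \<otimes>\<^bsub>E\<^esub> u"
      by (auto simp: multE mult_wreath add.commute intro!: restrict_ext)
  qed
  then have killN: "h ` top_derived \<Omega> (Suc k) = {\<one>\<^bsub>E\<^esub>}"
    using discrete_hom_top_derived[OF tg(1) E.is_group h] by simp
  interpret N: normal "top_derived \<Omega> (Suc k)" \<Omega> by (rule top_derived_normal[OF tg(1)])
  have "\<gamma> \<otimes>\<^bsub>\<Omega>\<^esub> \<iota>\<^sub>C c \<in> top_derived \<Omega> (Suc k) #>\<^bsub>\<Omega>\<^esub> (\<iota>\<^sub>C c \<otimes>\<^bsub>\<Omega>\<^esub> \<gamma>)"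
    using O.rcos_self[OF _ N.subgroup_axioms] comm \<gamma> ic by (metis O.m_closed)
  then obtain t where t: "t \<in> top_derived \<Omega> (Suc k)" "\<gamma> \<otimes>\<^bsub>\<Omega>\<^esub> \<iota>\<^sub>C c = t \<otimes>\<^bsub>\<Omega>\<^esub> (\<iota>\<^sub>C c \<otimes>\<^bsub>\<Omega>\<^esub> \<gamma>)"
    by (auto simp: r_coset_def)
  have "h t = \<one>\<^bsub>E\<^esub>" using killN t(1) by blast
  then have "h \<gamma> \<otimes>\<^bsub>E\<^esub> h (\<iota>\<^sub>C c) = h (\<iota>\<^sub>C c) \<otimes>\<^bsub>E\<^esub> h \<gamma>"
    using arg_cong[OF t(2), of h] N.mem_carrier[OF t(1)] \<gamma> ic by simp
  moreover obtain f where hf: "h \<gamma> = (f, \<psi> \<gamma>)" using snd[OF \<gamma>] by (metis prod.collapse)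
  ultimately have eq: "(f, \<psi> \<gamma>) \<otimes>\<^bsub>wreath l Q\<^esub> (?z, ?a) = (?z, ?a) \<otimes>\<^bsub>wreath l Q\<^esub> (f, \<psi> \<gamma>)"
    by (simp add: hC[OF c] multE)
  have "(f, \<psi> \<gamma>) \<in> derivation_lifts l Q A" using hc[OF \<gamma>] unfolding hf .
  then have "\<psi> \<gamma> \<in> A"
    by (rule derivation_lifts_commute[OF Q.is_group finQ A a l _ eq])
  then show ?thesis by (simp add: A_def)
qed

lemma discrete_hom_pair:
  assumes "h \<in> discrete_hom G Q" "k \<in> discrete_hom G R"
  shows "(\<lambda>x. (h x, k x)) \<in> discrete_hom G (Q \<times>\<times> R)"
proof -
  have "continuous_map (gtop G) (discrete_topology (carrier (Q \<times>\<times> R))) (\<lambda>x. (h x, k x))"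
    unfolding carrier_DirProd prod_topology_discrete_topology
    using assms by (intro continuous_map_pairedI) (simp_all add: discrete_hom_def)
  moreover have "(\<lambda>x. (h x, k x)) \<in> hom G (Q \<times>\<times> R)"
    using assms by (auto simp: discrete_hom_def hom_def)
  ultimately show ?thesis by (simp add: discrete_hom_def)
qed

text \<open>A \<open>\<gamma>\<close> outside the closed product set is separated from it by a
  finite quotient. This quotient is enlarged so that the image of \<open>c\<close> survives modulo
  that of \<open>T\<close>, then divided by the image of \<open>T\<close>;
  \<open>finite_quotient_centralizer\<close> yields a contradiction.\<close>

lemma centralizer_mod_top_derived:
  assumes F: "free_pro_sigma_product \<Sigma> C P \<Omega> \<iota>\<^sub>C \<iota>\<^sub>P"
    and x: "x \<in> carrier C" "closed_generate C {x} = carrier C"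
    and c: "c \<in> carrier C" "c \<noteq> \<one>\<^bsub>C\<^esub>" and k: "k \<ge> 1" and \<gamma>: "\<gamma> \<in> carrier \<Omega>"
    and comm: "top_derived \<Omega> (Suc k) #>\<^bsub>\<Omega>\<^esub> (\<gamma> \<otimes>\<^bsub>\<Omega>\<^esub> \<iota>\<^sub>C c) = top_derived \<Omega> (Suc k) #>\<^bsub>\<Omega>\<^esub> (\<iota>\<^sub>C c \<otimes>\<^bsub>\<Omega>\<^esub> \<gamma>)"
  shows "\<gamma> \<in> closed_generate \<Omega> {\<iota>\<^sub>C x} <#>\<^bsub>\<Omega>\<^esub> top_derived \<Omega> k"
proof (rule ccontr)
  have pro: "pro_sigma_group \<Sigma> \<Omega>" "pro_sigma_group \<Sigma> C"
    and tg: "topological_group \<Omega>" "topological_group C" "topological_group P"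
    and i: "\<iota>\<^sub>C \<in> cont_hom C \<Omega>" "\<iota>\<^sub>P \<in> cont_hom P \<Omega>"
    using F by (simp_all add: free_pro_sigma_product_def pro_sigma_group_def)
  interpret O: group \<Omega> by (rule topological_groupD(1)[OF tg(1)])
  interpret C: group C by (rule topological_groupD(1)[OF tg(2)])
  have ix: "\<iota>\<^sub>C x \<in> carrier \<Omega>" and ic: "\<iota>\<^sub>C c \<in> carrier \<Omega>"
    using i(1) x(1) c(1) by (auto simp: cont_hom_def hom_def)
  define K where "K = closed_generate \<Omega> {\<iota>\<^sub>C x}"
  define T where "T = top_derived \<Omega> k"
  interpret T: normal T \<Omega> unfolding T_def by (rule top_derived_normal[OF tg(1)])
  have K: "K \<subseteq> carrier \<Omega>"
    using closure_of_subset_topspace[of "gtop \<Omega>"] topological_groupD(2)[OF tg(1)] by (auto simp: K_def closed_generate_def)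
  assume "\<gamma> \<notin> closed_generate \<Omega> {\<iota>\<^sub>C x} <#>\<^bsub>\<Omega>\<^esub> top_derived \<Omega> k"
  then have notin: "\<gamma> \<notin> K <#>\<^bsub>\<Omega>\<^esub> T" by (simp add: K_def T_def)
  \<comment> \<open>Writing \<open>k\<close> as a successor exhibits \<open>T\<close> as a closure,
    hence closed, and as the closure of a commutator subgroup.\<close>
  obtain k' where k': "k = Suc k'" using k by (cases k) auto
  have "closedin (gtop \<Omega>) (K <#>\<^bsub>\<Omega>\<^esub> T)"
    by (rule closedin_set_mult[OF pro(1)]) (simp_all add: K_def closed_generate_def T_def k')
  then have "openin (gtop \<Omega>) (carrier \<Omega> - (K <#>\<^bsub>\<Omega>\<^esub> T))"
    using topological_groupD(2)[OF tg(1)] by (metis closedin_def)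
  then obtain Q1 :: "nat monoid" and p where Q1: "finite_sigma_group \<Sigma> Q1" and p: "p \<in> discrete_hom \<Omega> Q1"
    and sep: "\<And>z. \<lbrakk>z \<in> carrier \<Omega>; p z = p \<gamma>\<rbrakk> \<Longrightarrow> z \<notin> K <#>\<^bsub>\<Omega>\<^esub> T"
    using pro_sigma_group_separation[OF pro(1), of "carrier \<Omega> - (K <#>\<^bsub>\<Omega>\<^esub> T)" \<gamma>] \<gamma> notin by (metis DiffD2 DiffI)
  obtain Q2 :: "nat monoid" and r where Q2: "finite_sigma_group \<Sigma> Q2" and r: "r \<in> discrete_hom C Q2"
    and rc: "r c \<noteq> r \<one>\<^bsub>C\<^esub>"
    using pro_sigma_group_separation_neq[OF pro(2) c(1) C.one_closed c(2)] by blast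
  interpret Q2: group Q2 by (rule finite_sigma_groupD(1)[OF Q2])
  interpret r: group_hom C Q2 r by (rule discrete_hom_group_hom[OF r C.is_group Q2.is_group])
  \<comment> \<open>A cyclic quotient of \<open>C\<close> in which \<open>c\<close> is nontrivial.
    It is extended to \<open>\<Omega>\<close> trivially on \<open>P\<close>, and being abelian it
    kills \<open>T\<close>.\<close>
  define B where "B = Q2\<lparr>carrier := generate Q2 {r x}\<rparr>"
  have gen: "subgroup (generate Q2 {r x}) Q2" using x(1) by (intro Q2.generate_is_subgroup) auto
  have B: "finite_sigma_group \<Sigma> B" unfolding B_def by (rule finite_sigma_subgroup[OF Q2 gen])
  interpret B: group B by (rule finite_sigma_groupD(1)[OF B])
  have rB: "r \<in> discrete_hom C B"
    unfolding B_def
  proof (rule discrete_hom_restrict[OF r])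
    show "r ` carrier C \<subseteq> generate Q2 {r x}"
      using discrete_hom_closed_generate[OF tg(2) Q2.is_group r, of "{x}"] x by simp
  qed (use subgroup.subset[OF gen] topological_groupD(2)[OF tg(2)] in auto)
  have tr: "(\<lambda>_. \<one>\<^bsub>B\<^esub>) \<in> discrete_hom P B"
    by (simp add: discrete_hom_def hom_def)
  obtain \<rho> where \<rho>: "\<rho> \<in> discrete_hom \<Omega> B" and \<rho>C: "\<And>z. z \<in> carrier C \<Longrightarrow> \<rho> (\<iota>\<^sub>C z) = r z"
    by (rule free_pro_sigma_product_lift[OF F B rB tr]) blast
  interpret \<rho>: group_hom \<Omega> B \<rho> by (rule discrete_hom_group_hom[OF \<rho> O.is_group B.is_group])
  have \<rho>T: "\<rho> ` T = {\<one>\<^bsub>B\<^esub>}"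
    unfolding T_def k' discrete_hom_top_derived[OF tg(1) B.is_group \<rho>]
  proof (rule B.derived_commuting)
    show sub: "\<rho> ` top_derived \<Omega> k' \<subseteq> carrier B" using top_derived_subset[OF tg(1), of k'] by auto
    fix u v assume "u \<in> \<rho> ` top_derived \<Omega> k'" "v \<in> \<rho> ` top_derived \<Omega> k'"
    then have "u \<in> generate Q2 {r x}" "v \<in> generate Q2 {r x}" using sub by (auto simp: B_def)
    then obtain a b :: int where ab: "u = r x [^]\<^bsub>Q2\<^esub> a" "v = r x [^]\<^bsub>Q2\<^esub> b"
      using Q2.generate_pow[of "r x"] x(1) by auto
    have "r x [^]\<^bsub>Q2\<^esub> a \<otimes>\<^bsub>Q2\<^esub> r x [^]\<^bsub>Q2\<^esub> b = r x [^]\<^bsub>Q2\<^esub> b \<otimes>\<^bsub>Q2\<^esub> r x [^]\<^bsub>Q2\<^esub> a"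
      using x(1) by (simp add: Q2.int_pow_mult[symmetric] add.commute)
    then show "u \<otimes>\<^bsub>B\<^esub> v = v \<otimes>\<^bsub>B\<^esub> u" by (simp add: ab B_def)
  qed
  define D where "D = Q1 \<times>\<times> B"
  \<comment> \<open>The first component keeps \<open>\<gamma>\<close> away from the product set, the
    second keeps \<open>c\<close> away from \<open>T\<close>.\<close>
  define \<sigma> where "\<sigma> z = (p z, \<rho> z)" for z
  have D: "finite_sigma_group \<Sigma> D" unfolding D_def by (rule finite_sigma_DirProd[OF Q1 B])
  have \<sigma>D: "\<sigma> \<in> discrete_hom \<Omega> D" unfolding D_def \<sigma>_def[abs_def] by (rule discrete_hom_pair[OF p \<rho>])
  interpret \<sigma>D: group_hom \<Omega> D \<sigma>
    by (rule discrete_hom_group_hom[OF \<sigma>D O.is_group finite_sigma_groupD(1)[OF D]])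
  \<comment> \<open>Passing to the image makes \<open>\<sigma>\<close> surjective, so that the image
    of \<open>T\<close> is normal.\<close>
  define E where "E = D\<lparr>carrier := \<sigma> ` carrier \<Omega>\<rparr>"
  have E: "finite_sigma_group \<Sigma> E"
    unfolding E_def by (rule finite_sigma_subgroup[OF D \<sigma>D.img_is_subgroup])
  interpret E: group E by (rule finite_sigma_groupD(1)[OF E])
  have \<sigma>: "\<sigma> \<in> discrete_hom \<Omega> E"
    unfolding E_def using topological_groupD(2)[OF tg(1)] by (intro discrete_hom_restrict[OF \<sigma>D]) auto
  interpret \<sigma>: group_hom \<Omega> E \<sigma> by (rule discrete_hom_group_hom[OF \<sigma> O.is_group E.is_group])
  have "\<sigma> ` T \<lhd> E"
    by (rule T.surj_hom_normal_subgroup[OF \<sigma>.group_hom_axioms]) (simp add: E_def)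
  then interpret N: normal "\<sigma> ` T" E .
  define Q where "Q = E Mod \<sigma> ` T"
  define \<psi> where "\<psi> z = \<sigma> ` T #>\<^bsub>E\<^esub> \<sigma> z" for z
  have Q: "finite_sigma_group \<Sigma> Q" unfolding Q_def by (rule finite_sigma_Mod[OF E N.normal_axioms])
  have \<psi>: "\<psi> \<in> discrete_hom \<Omega> Q"
    unfolding Q_def \<psi>_def[abs_def] by (rule discrete_hom_compose[OF \<sigma> N.r_coset_hom_Mod])
  have "\<psi> ` top_derived \<Omega> k \<subseteq> {\<one>\<^bsub>Q\<^esub>}"
    using E.is_group N.rcos_const by (auto simp: \<psi>_def Q_def T_def)
  moreover have "\<psi> (\<iota>\<^sub>C c) \<noteq> \<one>\<^bsub>Q\<^esub>"
  proof
    assume "\<psi> (\<iota>\<^sub>C c) = \<one>\<^bsub>Q\<^esub>"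
    then have "\<sigma> (\<iota>\<^sub>C c) \<in> \<sigma> ` T"
      using E.rcos_self[OF \<sigma>.hom_closed[OF ic] N.subgroup_axioms] by (simp add: \<psi>_def Q_def)
    then have "\<rho> (\<iota>\<^sub>C c) \<in> \<rho> ` T" by (auto simp: \<sigma>_def)
    then have "r c = \<one>\<^bsub>B\<^esub>" using \<rho>T \<rho>C[OF c(1)] by simp
    then show False using rc by (simp add: B_def)
  qed
  ultimately have "\<psi> \<gamma> \<in> generate Q {\<psi> (\<iota>\<^sub>C x)}"
    by (rule finite_quotient_centralizer[OF F x Q \<psi> _ c(1) _ \<gamma> comm])
  also have "generate Q {\<psi> (\<iota>\<^sub>C x)} = \<psi> ` K"
    using discrete_hom_closed_generate[OF tg(1) finite_sigma_groupD(1)[OF Q] \<psi>, of "{\<iota>\<^sub>C x}"] ix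
    by (simp add: K_def)
  finally obtain \<kappa> where \<kappa>: "\<kappa> \<in> K" "\<psi> \<gamma> = \<psi> \<kappa>" by blast
  then have \<kappa>c: "\<kappa> \<in> carrier \<Omega>" using K by blast
  have "\<sigma> \<gamma> \<in> \<sigma> ` T #>\<^bsub>E\<^esub> \<sigma> \<kappa>"
    using E.rcos_self[OF \<sigma>.hom_closed[OF \<gamma>] N.subgroup_axioms] \<kappa>(2) by (simp add: \<psi>_def)
  then obtain t where t: "t \<in> T" "\<sigma> \<gamma> = \<sigma> t \<otimes>\<^bsub>E\<^esub> \<sigma> \<kappa>" by (auto simp: r_coset_def)
  then have "\<sigma> \<gamma> = \<sigma> (t \<otimes>\<^bsub>\<Omega>\<^esub> \<kappa>)" using T.mem_carrier \<kappa>c \<sigma>.hom_mult by metis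
  then have "p (t \<otimes>\<^bsub>\<Omega>\<^esub> \<kappa>) = p \<gamma>" by (simp add: \<sigma>_def)
  \<comment> \<open>Normality of \<open>T\<close> moves \<open>t\<close> to the right of
    \<open>\<kappa>\<close>, so this element lies in the product set although \<open>p\<close> does
    not distinguish it from \<open>\<gamma>\<close>.\<close>
  moreover have "t \<otimes>\<^bsub>\<Omega>\<^esub> \<kappa> = \<kappa> \<otimes>\<^bsub>\<Omega>\<^esub> (inv\<^bsub>\<Omega>\<^esub> \<kappa> \<otimes>\<^bsub>\<Omega>\<^esub> t \<otimes>\<^bsub>\<Omega>\<^esub> \<kappa>)"
    using T.mem_carrier[OF t(1)] \<kappa>c by (simp add: O.m_assoc[symmetric])
  then have "t \<otimes>\<^bsub>\<Omega>\<^esub> \<kappa> \<in> K <#>\<^bsub>\<Omega>\<^esub> T"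
    using T.inv_op_closed1[OF \<kappa>c t(1)] \<kappa>(1) by (auto simp: set_mult_def)
  ultimately show False using sep T.mem_carrier[OF t(1)] \<kappa>c by blast
qed

theorem proposition1p3:
  fixes \<Sigma> :: "nat set"
    and C :: "'a topgroup" and P :: "'b topgroup" and \<Omega> :: "'c topgroup"
    and \<iota>\<^sub>C :: "'a \<Rightarrow> 'c" and \<iota>\<^sub>P :: "'b \<Rightarrow> 'c"
    and x :: 'a and m :: nat and n :: int
  assumes "\<Sigma> \<noteq> {}" and "\<And>p. p \<in> \<Sigma> \<Longrightarrow> prime p"
    and "pro_sigma_group \<Sigma> C" and "pro_sigma_group \<Sigma> P"
    and "x \<in> carrier C" and "closed_generate C {x} = carrier C"
    and "free_pro_sigma_product \<Sigma> C P \<Omega> \<iota>\<^sub>C \<iota>\<^sub>P"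
    and "m \<ge> 2"
    and "x [^]\<^bsub>C\<^esub> n \<noteq> \<one>\<^bsub>C\<^esub>"
  shows "centralizer (solv_quotient \<Omega> m) (solv_proj \<Omega> m (\<iota>\<^sub>C (x [^]\<^bsub>C\<^esub> n)))
           \<subseteq> closed_generate (solv_quotient \<Omega> m) {solv_proj \<Omega> m (\<iota>\<^sub>C x)}
             <#>\<^bsub>solv_quotient \<Omega> m\<^esub> top_derived (solv_quotient \<Omega> m) (m - 1)"
proof
  have tg: "topological_group \<Omega>" "topological_group C" and i: "\<iota>\<^sub>C \<in> cont_hom C \<Omega>"
    using assms(7) by (simp_all add: free_pro_sigma_product_def pro_sigma_group_def)
  interpret O: group \<Omega> by (rule topological_groupD(1)[OF tg(1)])
  interpret C: group C by (rule topological_groupD(1)[OF tg(2)])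
  define N where "N = top_derived \<Omega> m"
  define S where "S = solv_quotient \<Omega> m"
  have S: "S = quotient_topgroup \<Omega> N" by (simp add: S_def solv_quotient_def N_def)
  define \<pi> where "\<pi> = solv_proj \<Omega> m"
  have \<pi>: "\<pi> g = N #>\<^bsub>\<Omega>\<^esub> g" for g by (simp add: \<pi>_def solv_proj_def N_def)
  have N: "N \<lhd> \<Omega>" unfolding N_def by (rule top_derived_normal[OF tg(1)])
  have cont: "\<pi> \<in> cont_hom \<Omega> S"
    using quotient_topgroup_proj[OF tg(1) N] by (simp add: S \<pi>[abs_def])
  interpret \<pi>: group_hom \<Omega> S \<pi>
    using cont group_quotient_topgroup[OF N] O.is_group by (simp add: group_hom_def group_hom_axioms_def cont_hom_def S)
  let ?c = "x [^]\<^bsub>C\<^esub> n"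
  have c: "?c \<in> carrier C" using assms(5) by simp
  then have ic: "\<iota>\<^sub>C ?c \<in> carrier \<Omega>" "\<iota>\<^sub>C x \<in> carrier \<Omega>" using i assms(5) by (auto simp: cont_hom_def hom_def)
  fix g assume g: "g \<in> centralizer (solv_quotient \<Omega> m) (solv_proj \<Omega> m (\<iota>\<^sub>C ?c))"
  then have "g \<in> carrier S" by (simp add: centralizer_def S_def)
  then obtain \<gamma> where \<gamma>: "\<gamma> \<in> carrier \<Omega>" "g = \<pi> \<gamma>" by (auto simp: S carrier_FactGroup \<pi>)
  have "\<pi> \<gamma> \<otimes>\<^bsub>S\<^esub> \<pi> (\<iota>\<^sub>C ?c) = \<pi> (\<iota>\<^sub>C ?c) \<otimes>\<^bsub>S\<^esub> \<pi> \<gamma>"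
    using g by (simp add: centralizer_def S_def[symmetric] \<pi>_def[symmetric] \<gamma>(2))
  then have "\<pi> (\<gamma> \<otimes>\<^bsub>\<Omega>\<^esub> \<iota>\<^sub>C ?c) = \<pi> (\<iota>\<^sub>C ?c \<otimes>\<^bsub>\<Omega>\<^esub> \<gamma>)" using \<gamma>(1) ic by simp
  \<comment> \<open>The previous lemma is applied with \<open>k = m - 1\<close>; its condition
    \<open>k \<ge> 1\<close> is exactly \<open>m \<ge> 2\<close>.\<close>
  moreover have m: "m = Suc (m - 1)" "m - 1 \<ge> 1" using assms(8) by auto
  ultimately have "\<gamma> \<in> closed_generate \<Omega> {\<iota>\<^sub>C x} <#>\<^bsub>\<Omega>\<^esub> top_derived \<Omega> (m - 1)"
    unfolding \<pi> N_def
    by (intro centralizer_mod_top_derived[OF assms(7,5,6) c assms(9) m(2) \<gamma>(1)]) (metis m(1))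
  then obtain \<kappa> t where \<kappa>: "\<kappa> \<in> closed_generate \<Omega> {\<iota>\<^sub>C x}" and t: "t \<in> top_derived \<Omega> (m - 1)"
    and eq: "\<gamma> = \<kappa> \<otimes>\<^bsub>\<Omega>\<^esub> t"
    by (auto simp: set_mult_def)
  \<comment> \<open>The factorization found in \<open>\<Omega>\<close> is pushed down to the
    quotient. Inclusions suffice, and they follow from continuity of \<open>\<pi>\<close>.\<close>
  have "\<pi> ` closed_generate \<Omega> {\<iota>\<^sub>C x} \<subseteq> gtop S closure_of (\<pi> ` generate \<Omega> {\<iota>\<^sub>C x})"
    using cont by (simp add: closed_generate_def cont_hom_def continuous_map_image_closure_subset)
  also have "\<dots> = closed_generate S {\<pi> (\<iota>\<^sub>C x)}"
    using \<pi>.generate_img[of "{\<iota>\<^sub>C x}"] ic by (simp add: closed_generate_def)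
  finally have "\<pi> \<kappa> \<in> closed_generate S {\<pi> (\<iota>\<^sub>C x)}" using \<kappa> by blast
  moreover have "\<pi> t \<in> top_derived S (m - 1)"
    using cont_hom_top_derived[OF O.is_group \<pi>.H.is_group cont top_derived_subset[OF tg(1)]] t by blast
  moreover have "g = \<pi> \<kappa> \<otimes>\<^bsub>S\<^esub> \<pi> t"
  proof -
    have "\<kappa> \<in> carrier \<Omega>"
      using \<kappa> closure_of_subset_topspace[of "gtop \<Omega>"] topological_groupD(2)[OF tg(1)]
      by (auto simp: closed_generate_def)
    moreover have "t \<in> carrier \<Omega>" using t top_derived_subset[OF tg(1)] by blast
    ultimately show ?thesis by (simp add: \<gamma>(2) eq)
  qed
  ultimately show "g \<in> closed_generate (solv_quotient \<Omega> m) {solv_proj \<Omega> m (\<iota>\<^sub>C x)}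
      <#>\<^bsub>solv_quotient \<Omega> m\<^esub> top_derived (solv_quotient \<Omega> m) (m - 1)"
    unfolding S_def[symmetric] \<pi>_def[symmetric] by (auto simp: set_mult_def)
qed

end
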